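(* Let $\mathcal M\models T$, $k\in\mathbb N$ and $a\in M^k$. The function $d_{\mathcal G}:\mathcal G\times\mathcal G\to\mathcal K$ on the set $\mathcal G=\mathcal G_a$ of germs of $\mathcal L$-definable curves in $M^k$ at $a$ is a well-defined $\mathcal K$-metric on $\mathcal G$ (that is, independent of representatives, zero exactly on the diagonal, symmetric, and satisfying the triangle inequality in the ordered field $\mathcal K$).
   Context: $T$ is a complete o-minimal theory expanding the theory of real closed ordered fields in a language $\mathcal L$, with quantifier elimination and universally axiomatizable; definable means definable with parameters. $\mathcal K=\mathcal H_{0^+}$ is the Hardy field of germs at $0^+$ of $\mathcal L(M)$-definable unary functions: two such functions have the same germ if they agree on some interval $(0,c)$ with $c>0$, and $\mathcal K$ is an ordered field under the operations and order induced from representatives. The germ of $f$ is written $[f]_{\mathcal K}$. $d(x,y)=\max_{i=1}^k|x_i-y_i|$ is the sup metric on $M^k$, and $B(a,\varepsilon)$ is the corresponding ball. A curve at $a$ is a continuous function $\gamma:(0,1)\to M^k$ with $\lim_{t\to0}\gamma(t)=a$. For two curves $\gamma,\sigma$ at $a$, write $\gamma\sim\sigma$ if there is $\varepsilon>0$ with $B(a,\varepsilon)\cap\gamma((0,1))=B(a,\varepsilon)\cap\sigma((0,1))$. The class of $\gamma$ is denoted $[\gamma]$, and $\mathcal G_a$ is the set of classes (germs) of $\mathcal L$-definable curves in $M^k$ at $a$. The function $d_{\mathcal G}$ is defined by $d_{\mathcal G}([\gamma],[\sigma])=[f]_{\mathcal K}$, where, for all sufficiently small $t>0$, $$f(t)=D\bigl(B(a,t)\cap\gamma((0,1)),\,B(a,t)\cap\sigma((0,1))\bigr)$$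 and $D$ is the Hausdorff distance induced by $d$.
   Formalization: "Zero exactly on the diagonal" fails if one of two curves passes through a (t and min(t,|t-1/2|) at 0); proved instead: distance zero iff the images agree near a up to the point a, so a K-metric on germs avoiding a and on germs through a; all else holds on all of G. *)

theory Defs
  imports "HOL-Algebra.Polynomials" "HOL-Library.Lub_Glb"
begin

section \<open>First-order logic\<close>

text \<open>
  A language consists of all symbols of the types \<open>'f\<close> (functions; arity 0 for constants) and
  \<open>'r\<close> (relations). The named symbols single out the language of ordered rings
  (with unary minus) inside it.
\<close>

record ('f, 'r) language =
  fun_arity :: "'f \<Rightarrow> nat"
  rel_arity :: "'r \<Rightarrow> nat"
  zero_sym :: 'f
  one_sym :: 'f
  plus_sym :: 'f
  minus_sym :: 'f
  times_sym :: 'f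
  less_sym :: 'r

definition expands_ordered_ring_language :: "('f, 'r) language \<Rightarrow> bool" where
  "expands_ordered_ring_language L \<longleftrightarrow>
     fun_arity L (zero_sym L) = 0 \<and> fun_arity L (one_sym L) = 0 \<and>
     fun_arity L (plus_sym L) = 2 \<and> fun_arity L (minus_sym L) = 1 \<and>
     fun_arity L (times_sym L) = 2 \<and> rel_arity L (less_sym L) = 2"

datatype 'f trm = Var nat | Fun 'f "'f trm list"

datatype ('f, 'r) fm =
    Eq "'f trm" "'f trm"
  | Rel 'r "'f trm list"
  | Neg "('f, 'r) fm"
  | And "('f, 'r) fm" "('f, 'r) fm"
  | All nat "('f, 'r) fm"

fun trm_vars :: "'f trm \<Rightarrow> nat set" where
  "trm_vars (Var i) = {i}"
| "trm_vars (Fun f ts) = (\<Union>t\<in>set ts. trm_vars t)"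

fun wf_trm :: "('f, 'r) language \<Rightarrow> 'f trm \<Rightarrow> bool" where
  "wf_trm L (Var i) \<longleftrightarrow> True"
| "wf_trm L (Fun f ts) \<longleftrightarrow> length ts = fun_arity L f \<and> (\<forall>t\<in>set ts. wf_trm L t)"

primrec free_vars :: "('f, 'r) fm \<Rightarrow> nat set" where
  "free_vars (Eq s t) = trm_vars s \<union> trm_vars t"
| "free_vars (Rel r ts) = (\<Union>t\<in>set ts. trm_vars t)"
| "free_vars (Neg \<phi>) = free_vars \<phi>"
| "free_vars (And \<phi> \<psi>) = free_vars \<phi> \<union> free_vars \<psi>"
| "free_vars (All x \<phi>) = free_vars \<phi> - {x}"

primrec wf_fm :: "('f, 'r) language \<Rightarrow> ('f, 'r) fm \<Rightarrow> bool" where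
  "wf_fm L (Eq s t) \<longleftrightarrow> wf_trm L s \<and> wf_trm L t"
| "wf_fm L (Rel r ts) \<longleftrightarrow> length ts = rel_arity L r \<and> (\<forall>t\<in>set ts. wf_trm L t)"
| "wf_fm L (Neg \<phi>) \<longleftrightarrow> wf_fm L \<phi>"
| "wf_fm L (And \<phi> \<psi>) \<longleftrightarrow> wf_fm L \<phi> \<and> wf_fm L \<psi>"
| "wf_fm L (All x \<phi>) \<longleftrightarrow> wf_fm L \<phi>"

definition sentence :: "('f, 'r) language \<Rightarrow> ('f, 'r) fm \<Rightarrow> bool" where
  "sentence L \<phi> \<longleftrightarrow> wf_fm L \<phi> \<and> free_vars \<phi> = {}"

primrec quantifier_free :: "('f, 'r) fm \<Rightarrow> bool" where
  "quantifier_free (Eq s t) \<longleftrightarrow> True"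
| "quantifier_free (Rel r ts) \<longleftrightarrow> True"
| "quantifier_free (Neg \<phi>) \<longleftrightarrow> quantifier_free \<phi>"
| "quantifier_free (And \<phi> \<psi>) \<longleftrightarrow> quantifier_free \<phi> \<and> quantifier_free \<psi>"
| "quantifier_free (All x \<phi>) \<longleftrightarrow> False"

inductive universal_fm :: "('f, 'r) fm \<Rightarrow> bool" where
  "quantifier_free \<phi> \<Longrightarrow> universal_fm \<phi>"
| "universal_fm \<phi> \<Longrightarrow> universal_fm (All x \<phi>)"

record ('f, 'r, 'u) fo_structure =
  univ :: "'u set"
  fun_int :: "'f \<Rightarrow> 'u list \<Rightarrow> 'u"
  rel_int :: "'r \<Rightarrow> 'u list \<Rightarrow> bool"

definition is_structure :: "('f, 'r) language \<Rightarrow> ('f, 'r, 'u) fo_structure \<Rightarrow> bool" where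
  "is_structure L N \<longleftrightarrow> univ N \<noteq> {} \<and>
     (\<forall>f xs. length xs = fun_arity L f \<and> set xs \<subseteq> univ N \<longrightarrow> fun_int N f xs \<in> univ N)"

fun trm_val :: "('f, 'r, 'u) fo_structure \<Rightarrow> (nat \<Rightarrow> 'u) \<Rightarrow> 'f trm \<Rightarrow> 'u" where
  "trm_val N e (Var i) = e i"
| "trm_val N e (Fun f ts) = fun_int N f (map (trm_val N e) ts)"

primrec sat :: "('f, 'r, 'u) fo_structure \<Rightarrow> (nat \<Rightarrow> 'u) \<Rightarrow> ('f, 'r) fm \<Rightarrow> bool" where
  "sat N e (Eq s t) \<longleftrightarrow> trm_val N e s = trm_val N e t"
| "sat N e (Rel r ts) \<longleftrightarrow> rel_int N r (map (trm_val N e) ts)"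
| "sat N e (Neg \<phi>) \<longleftrightarrow> \<not> sat N e \<phi>"
| "sat N e (And \<phi> \<psi>) \<longleftrightarrow> sat N e \<phi> \<and> sat N e \<psi>"
| "sat N e (All x \<phi>) \<longleftrightarrow> (\<forall>u\<in>univ N. sat N (e(x := u)) \<phi>)"

definition assignments :: "('f, 'r, 'u) fo_structure \<Rightarrow> (nat \<Rightarrow> 'u) set" where
  "assignments N = {e. range e \<subseteq> univ N}"

definition models :: "('f, 'r) language \<Rightarrow> ('f, 'r, 'u) fo_structure \<Rightarrow> ('f, 'r) fm set \<Rightarrow> bool" where
  "models L N T \<longleftrightarrow> is_structure L N \<and> (\<forall>\<phi>\<in>T. \<forall>e\<in>assignments N. sat N e \<phi>)"

definition definable :: "('f, 'r) language \<Rightarrow> ('f, 'r, 'u) fo_structure \<Rightarrow> nat \<Rightarrow> 'u list set \<Rightarrow> bool" where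
  \<comment> \<open>with parameters: variables \<open>i \<ge> n\<close> take their values from the assignment \<open>e\<close>\<close>
  "definable L N n S \<longleftrightarrow> (\<exists>\<phi>. wf_fm L \<phi> \<and> (\<exists>e\<in>assignments N.
     S = {xs. length xs = n \<and> set xs \<subseteq> univ N \<and> sat N (\<lambda>i. if i < n then xs ! i else e i) \<phi>}))"


section \<open>Theories\<close>

text \<open>
  Properties of a theory refer to all of its models; here these range over the structures whose
  universe is a subset of a given type \<open>'u\<close>. By Loewenheim-Skolem the notions below coincide with
  the type-independent ones as soon as \<open>'u\<close> has at least as many elements as there are formulas,
  as does any type of the form \<open>'m + ('f, 'r) fm\<close>.
\<close>

definition complete_theory ::
    "'u itself \<Rightarrow> ('f, 'r) language \<Rightarrow> ('f, 'r) fm set \<Rightarrow> bool" where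
  "complete_theory _ L T \<longleftrightarrow>
     (\<exists>N :: ('f, 'r, 'u) fo_structure. models L N T) \<and>
     (\<forall>\<phi>. sentence L \<phi> \<longrightarrow>
        (\<forall>N :: ('f, 'r, 'u) fo_structure. models L N T \<longrightarrow> models L N {\<phi>}) \<or>
        (\<forall>N :: ('f, 'r, 'u) fo_structure. models L N T \<longrightarrow> models L N {Neg \<phi>}))"

definition has_quantifier_elimination ::
    "'u itself \<Rightarrow> ('f, 'r) language \<Rightarrow> ('f, 'r) fm set \<Rightarrow> bool" where
  "has_quantifier_elimination _ L T \<longleftrightarrow>
     (\<forall>\<phi>. wf_fm L \<phi> \<longrightarrow>
        (\<exists>\<psi>. wf_fm L \<psi> \<and> quantifier_free \<psi> \<and> free_vars \<psi> \<subseteq> free_vars \<phi> \<and>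
           (\<forall>N :: ('f, 'r, 'u) fo_structure. models L N T \<longrightarrow>
              (\<forall>e\<in>assignments N. sat N e \<phi> \<longleftrightarrow> sat N e \<psi>))))"

definition universally_axiomatizable ::
    "'u itself \<Rightarrow> ('f, 'r) language \<Rightarrow> ('f, 'r) fm set \<Rightarrow> bool" where
  "universally_axiomatizable _ L T \<longleftrightarrow>
     (\<exists>U. (\<forall>\<phi>\<in>U. sentence L \<phi> \<and> universal_fm \<phi>) \<and>
        (\<forall>N :: ('f, 'r, 'u) fo_structure. models L N T \<longleftrightarrow> models L N U))"

definition less_in :: "('f, 'r) language \<Rightarrow> ('f, 'r, 'u) fo_structure \<Rightarrow> 'u \<Rightarrow> 'u \<Rightarrow> bool" where
  "less_in L N x y \<longleftrightarrow> rel_int N (less_sym L) [x, y]"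

definition ring_reduct :: "('f, 'r) language \<Rightarrow> ('f, 'r, 'u) fo_structure \<Rightarrow> 'u ring" where
  "ring_reduct L N =
     \<lparr>carrier = univ N,
      mult = (\<lambda>x y. fun_int N (times_sym L) [x, y]), one = fun_int N (one_sym L) [],
      zero = fun_int N (zero_sym L) [], add = (\<lambda>x y. fun_int N (plus_sym L) [x, y])\<rparr>"

definition real_closed_ordered_field ::
    "('f, 'r) language \<Rightarrow> ('f, 'r, 'u) fo_structure \<Rightarrow> bool" where
  "real_closed_ordered_field L N \<longleftrightarrow>
     (let R = ring_reduct L N; lt = less_in L N in
        field R \<and>
        (\<forall>x\<in>carrier R. fun_int N (minus_sym L) [x] = \<ominus>\<^bsub>R\<^esub> x) \<and>
        (\<forall>x\<in>carrier R. \<not> lt x x) \<and>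
        (\<forall>x\<in>carrier R. \<forall>y\<in>carrier R. \<forall>z\<in>carrier R. lt x y \<and> lt y z \<longrightarrow> lt x z) \<and>
        (\<forall>x\<in>carrier R. \<forall>y\<in>carrier R. x = y \<or> lt x y \<or> lt y x) \<and>
        (\<forall>x\<in>carrier R. \<forall>y\<in>carrier R. \<forall>z\<in>carrier R. lt x y \<longrightarrow> lt (x \<oplus>\<^bsub>R\<^esub> z) (y \<oplus>\<^bsub>R\<^esub> z)) \<and>
        (\<forall>x\<in>carrier R. \<forall>y\<in>carrier R. lt \<zero>\<^bsub>R\<^esub> x \<and> lt \<zero>\<^bsub>R\<^esub> y \<longrightarrow> lt \<zero>\<^bsub>R\<^esub> (x \<otimes>\<^bsub>R\<^esub> y)) \<and>
        (\<forall>x\<in>carrier R. lt \<zero>\<^bsub>R\<^esub> x \<longrightarrow> (\<exists>y\<in>carrier R. x = y \<otimes>\<^bsub>R\<^esub> y)) \<and>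
        (\<forall>p. polynomial\<^bsub>R\<^esub> (carrier R) p \<and> odd (degree p) \<longrightarrow>
           (\<exists>x\<in>carrier R. ring.eval R p x = \<zero>\<^bsub>R\<^esub>)))"

definition expands_RCF :: "'u itself \<Rightarrow> ('f, 'r) language \<Rightarrow> ('f, 'r) fm set \<Rightarrow> bool" where
  "expands_RCF _ L T \<longleftrightarrow>
     (\<forall>N :: ('f, 'r, 'u) fo_structure. models L N T \<longrightarrow> real_closed_ordered_field L N)"

inductive point_or_open_interval ::
    "('f, 'r) language \<Rightarrow> ('f, 'r, 'u) fo_structure \<Rightarrow> 'u set \<Rightarrow> bool" for L N where
  "c \<in> univ N \<Longrightarrow> point_or_open_interval L N {c}"
| "\<lbrakk>c \<in> univ N; d \<in> univ N\<rbrakk> \<Longrightarrow>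
     point_or_open_interval L N {x \<in> univ N. less_in L N c x \<and> less_in L N x d}"
| "c \<in> univ N \<Longrightarrow> point_or_open_interval L N {x \<in> univ N. less_in L N c x}"
| "d \<in> univ N \<Longrightarrow> point_or_open_interval L N {x \<in> univ N. less_in L N x d}"
| "point_or_open_interval L N (univ N)"

definition o_minimal :: "('f, 'r) language \<Rightarrow> ('f, 'r, 'u) fo_structure \<Rightarrow> bool" where
  \<comment> \<open>only used alongside \<^const>\<open>expands_RCF\<close>, which makes \<^const>\<open>less_in\<close> a linear order\<close>
  "o_minimal L N \<longleftrightarrow>
     (\<forall>S. definable L N 1 S \<longrightarrow>
        (\<exists>\<I>. finite \<I> \<and> (\<forall>I\<in>\<I>. point_or_open_interval L N I) \<and> {x. [x] \<in> S} = \<Union>\<I>))"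

definition o_minimal_theory :: "'u itself \<Rightarrow> ('f, 'r) language \<Rightarrow> ('f, 'r) fm set \<Rightarrow> bool" where
  "o_minimal_theory _ L T \<longleftrightarrow>
     (\<forall>N :: ('f, 'r, 'u) fo_structure. models L N T \<longrightarrow> o_minimal L N)"

text \<open>
  A structure on a whole type that is itself an ordered field, with the symbols of the language of
  ordered rings interpreted by the operations of the type.
\<close>

definition ordered_field_structure ::
    "('f, 'r) language \<Rightarrow> ('f, 'r, 'm::linordered_field) fo_structure \<Rightarrow> bool" where
  "ordered_field_structure L M \<longleftrightarrow>
     univ M = UNIV \<and>
     fun_int M (zero_sym L) [] = 0 \<and> fun_int M (one_sym L) [] = 1 \<and>
     (\<forall>x y. fun_int M (plus_sym L) [x, y] = x + y) \<and>
     (\<forall>x. fun_int M (minus_sym L) [x] = - x) \<and>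
     (\<forall>x y. fun_int M (times_sym L) [x, y] = x * y) \<and>
     (\<forall>x y. rel_int M (less_sym L) [x, y] \<longleftrightarrow> x < y)"


section \<open>The Hardy field of germs at \<open>0\<^sup>+\<close>\<close>

definition near0 :: "('m::linordered_field \<Rightarrow> bool) \<Rightarrow> bool" where
  "near0 P \<longleftrightarrow> (\<exists>c>0. \<forall>t. 0 < t \<and> t < c \<longrightarrow> P t)"

definition definable_fun ::
    "('f, 'r) language \<Rightarrow> ('f, 'r, 'm) fo_structure \<Rightarrow> ('m \<Rightarrow> 'm) \<Rightarrow> bool" where
  "definable_fun L M f \<longleftrightarrow> definable L M 2 {[t, f t] | t. True}"

definition germ0 ::
    "('f, 'r) language \<Rightarrow> ('f, 'r, 'm::linordered_field) fo_structure \<Rightarrow> ('m \<Rightarrow> 'm) \<Rightarrow> ('m \<Rightarrow> 'm) set" where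
  \<comment> \<open>meaningful also if \<open>f\<close> merely agrees near \<open>0\<^sup>+\<close> with a definable function; empty otherwise\<close>
  "germ0 L M f = {g. definable_fun L M g \<and> near0 (\<lambda>t. f t = g t)}"

record 'a ordered_ring = "'a ring" +
  rle :: "'a \<Rightarrow> 'a \<Rightarrow> bool"

definition hardy_field ::
    "('f, 'r) language \<Rightarrow> ('f, 'r, 'm::linordered_field) fo_structure \<Rightarrow> ('m \<Rightarrow> 'm) set ordered_ring" where
  "hardy_field L M =
     \<lparr>carrier = {germ0 L M f | f. definable_fun L M f},
      mult = (\<lambda>F G. \<Union>f\<in>F. \<Union>g\<in>G. germ0 L M (\<lambda>t. f t * g t)),
      one = germ0 L M (\<lambda>t. 1),
      zero = germ0 L M (\<lambda>t. 0),
      add = (\<lambda>F G. \<Union>f\<in>F. \<Union>g\<in>G. germ0 L M (\<lambda>t. f t + g t)),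
      rle = (\<lambda>F G. \<exists>f\<in>F. \<exists>g\<in>G. near0 (\<lambda>t. f t \<le> g t))\<rparr>"

definition pseudometric_over :: "'k ordered_ring \<Rightarrow> 'x set \<Rightarrow> ('x \<Rightarrow> 'x \<Rightarrow> 'k) \<Rightarrow> bool" where
  "pseudometric_over K S d \<longleftrightarrow>
     (\<forall>x\<in>S. \<forall>y\<in>S. d x y \<in> carrier K \<and> rle K \<zero>\<^bsub>K\<^esub> (d x y)) \<and>
     (\<forall>x\<in>S. d x x = \<zero>\<^bsub>K\<^esub>) \<and>
     (\<forall>x\<in>S. \<forall>y\<in>S. d x y = d y x) \<and>
     (\<forall>x\<in>S. \<forall>y\<in>S. \<forall>z\<in>S. rle K (d x z) (d x y \<oplus>\<^bsub>K\<^esub> d y z))"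

definition metric_over :: "'k ordered_ring \<Rightarrow> 'x set \<Rightarrow> ('x \<Rightarrow> 'x \<Rightarrow> 'k) \<Rightarrow> bool" where
  "metric_over K S d \<longleftrightarrow>
     pseudometric_over K S d \<and> (\<forall>x\<in>S. \<forall>y\<in>S. d x y = \<zero>\<^bsub>K\<^esub> \<longleftrightarrow> x = y)"


section \<open>Curves and their germs\<close>

text \<open>\<open>M\<^sup>k\<close> is the set of lists of length \<open>k\<close>; for \<open>k = 0\<close> the maximum below is \<open>0\<close>.\<close>

definition sup_dist :: "'m::linordered_field list \<Rightarrow> 'm list \<Rightarrow> 'm" where
  "sup_dist x y = Max (insert 0 {\<bar>x ! i - y ! i\<bar> | i. i < length x})"

definition sup_ball :: "'m::linordered_field list \<Rightarrow> 'm \<Rightarrow> 'm list set" where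
  "sup_ball a \<epsilon> = {x. length x = length a \<and> sup_dist a x < \<epsilon>}"

text \<open>
  Suprema and infima need not exist in \<open>M\<close>; \<open>r\<close> is the Hausdorff distance of \<open>A\<close> and \<open>B\<close> if all
  those in the usual formula exist and yield \<open>r\<close>.
\<close>

definition is_hausdorff_dist ::
    "'m::linordered_field list set \<Rightarrow> 'm list set \<Rightarrow> 'm \<Rightarrow> bool" where
  "is_hausdorff_dist A B r \<longleftrightarrow> (\<exists>\<delta> \<delta>' u v.
     (\<forall>x\<in>A. isGlb UNIV (sup_dist x ` B) (\<delta> x)) \<and> isLub UNIV (\<delta> ` A) u \<and>
     (\<forall>y\<in>B. isGlb UNIV (sup_dist y ` A) (\<delta>' y)) \<and> isLub UNIV (\<delta>' ` B) v \<and>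
     r = max u v)"

definition hausdorff_dist :: "'m::linordered_field list set \<Rightarrow> 'm list set \<Rightarrow> 'm" where
  "hausdorff_dist A B = (THE r. is_hausdorff_dist A B r)"

text \<open>Curves are total functions of which only the restriction to \<open>(0,1)\<close> matters.\<close>

definition trace :: "('m::linordered_field \<Rightarrow> 'm list) \<Rightarrow> 'm list set" where
  "trace \<gamma> = \<gamma> ` {0<..<1}"

definition curves_at ::
    "('f, 'r) language \<Rightarrow> ('f, 'r, 'm::linordered_field) fo_structure \<Rightarrow> nat \<Rightarrow> 'm list
     \<Rightarrow> ('m \<Rightarrow> 'm list) set" where
  "curves_at L M k a = {\<gamma>.
     (\<forall>t\<in>{0<..<1}. length (\<gamma> t) = k) \<and>
     definable L M (Suc k) {t # \<gamma> t | t. t \<in> {0<..<1}} \<and>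
     (\<forall>t\<in>{0<..<1}. \<forall>\<epsilon>>0. \<exists>\<delta>>0. \<forall>s\<in>{0<..<1}. \<bar>s - t\<bar> < \<delta> \<longrightarrow> sup_dist (\<gamma> t) (\<gamma> s) < \<epsilon>) \<and>
     (\<forall>\<epsilon>>0. near0 (\<lambda>t. sup_dist a (\<gamma> t) < \<epsilon>))}"

definition curve_rel ::
    "('f, 'r) language \<Rightarrow> ('f, 'r, 'm::linordered_field) fo_structure \<Rightarrow> nat \<Rightarrow> 'm list
     \<Rightarrow> (('m \<Rightarrow> 'm list) \<times> ('m \<Rightarrow> 'm list)) set" where
  "curve_rel L M k a = {(\<gamma>, \<sigma>). \<gamma> \<in> curves_at L M k a \<and> \<sigma> \<in> curves_at L M k a \<and>
     (\<exists>\<epsilon>>0. sup_ball a \<epsilon> \<inter> trace \<gamma> = sup_ball a \<epsilon> \<inter> trace \<sigma>)}"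

definition curve_germ ::
    "('f, 'r) language \<Rightarrow> ('f, 'r, 'm::linordered_field) fo_structure \<Rightarrow> nat \<Rightarrow> 'm list
     \<Rightarrow> ('m \<Rightarrow> 'm list) \<Rightarrow> ('m \<Rightarrow> 'm list) set" where
  "curve_germ L M k a \<gamma> = curve_rel L M k a `` {\<gamma>}"

definition curve_germs ::
    "('f, 'r) language \<Rightarrow> ('f, 'r, 'm::linordered_field) fo_structure \<Rightarrow> nat \<Rightarrow> 'm list
     \<Rightarrow> ('m \<Rightarrow> 'm list) set set" where
  "curve_germs L M k a = curves_at L M k a // curve_rel L M k a"

definition local_dist ::
    "'m::linordered_field list \<Rightarrow> ('m \<Rightarrow> 'm list) \<Rightarrow> ('m \<Rightarrow> 'm list) \<Rightarrow> 'm \<Rightarrow> 'm" where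
  "local_dist a \<gamma> \<sigma> t = hausdorff_dist (sup_ball a t \<inter> trace \<gamma>) (sup_ball a t \<inter> trace \<sigma>)"

definition germ_dist ::
    "('f, 'r) language \<Rightarrow> ('f, 'r, 'm::linordered_field) fo_structure \<Rightarrow> 'm list
     \<Rightarrow> ('m \<Rightarrow> 'm list) set \<Rightarrow> ('m \<Rightarrow> 'm list) set \<Rightarrow> ('m \<Rightarrow> 'm) set" where
  "germ_dist L M a g h = the_elem (\<Union>\<gamma>\<in>g. \<Union>\<sigma>\<in>h. {germ0 L M (local_dist a \<gamma> \<sigma>)})"

definition germ_dist_well_defined ::
    "('f, 'r) language \<Rightarrow> ('f, 'r, 'm::linordered_field) fo_structure \<Rightarrow> nat \<Rightarrow> 'm list \<Rightarrow> bool" where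
  "germ_dist_well_defined L M k a \<longleftrightarrow>
     equiv (curves_at L M k a) (curve_rel L M k a) \<and>
     (\<forall>\<gamma>\<in>curves_at L M k a. \<forall>\<sigma>\<in>curves_at L M k a.
        near0 (\<lambda>t. \<exists>!r. is_hausdorff_dist (sup_ball a t \<inter> trace \<gamma>) (sup_ball a t \<inter> trace \<sigma>) r) \<and>
        germ0 L M (local_dist a \<gamma> \<sigma>) \<in> carrier (hardy_field L M) \<and>
        germ_dist L M a (curve_germ L M k a \<gamma>) (curve_germ L M k a \<sigma>)
          = germ0 L M (local_dist a \<gamma> \<sigma>)) \<and>
     (\<lambda>\<gamma> \<sigma>. germ0 L M (local_dist a \<gamma> \<sigma>)) respects2 curve_rel L M k a"

text \<open>
  A curve at \<open>a\<close> may pass through \<open>a\<close>. The Hausdorff distance does not distinguish a set from its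
  closure, hence does not see whether it does: for \<open>a = 0\<close> in \<open>M\<close>, the curves \<open>t\<close> and
  \<open>min t \<bar>t - 1/2\<bar>\<close> have traces \<open>(0,1)\<close> and \<open>[0,1/2)\<close>, which are not equivalent although their
  distance is zero. Curves are therefore separated only up to the point \<open>a\<close> itself.
\<close>

definition same_off_center :: "'m::linordered_field list \<Rightarrow> ('m \<Rightarrow> 'm list) \<Rightarrow> ('m \<Rightarrow> 'm list) \<Rightarrow> bool" where
  "same_off_center a \<gamma> \<sigma> \<longleftrightarrow>
     (\<exists>\<epsilon>>0. sup_ball a \<epsilon> \<inter> trace \<gamma> - {a} = sup_ball a \<epsilon> \<inter> trace \<sigma> - {a})"

definition passes_through_center :: "'m::linordered_field list \<Rightarrow> ('m \<Rightarrow> 'm list) set \<Rightarrow> bool" where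
  "passes_through_center a g \<longleftrightarrow> (\<exists>\<gamma>\<in>g. a \<in> trace \<gamma>)"

end

theory Submission
  imports Defs
begin

text \<open>
  For subsets \<open>A\<close>, \<open>B\<close> of \<open>M\<^sup>k\<close> the Hausdorff distance is at most \<open>r\<close> iff for every
  \<open>\<epsilon> > 0\<close> each point of one set has a point of the other within \<open>r + \<epsilon>\<close>. For traces of
  definable curves this condition on \<open>r\<close> is first-order, so definable completeness of o-minimal
  structures provides the suprema and infima in the definition, and the resulting function of the
  radius is definable. Symmetry and the triangle inequality are then immediate.

  If the distance is \<open>0\<close> for small radii, the two traces have the same closure near \<open>a\<close>.
  By o-minimality, a point to which the curve comes arbitrarily close as \<open>t \<rightarrow> 1\<close> is the limit of
  the curve there; hence there is at most one such point, and in a small ball around \<open>a\<close> the trace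
  is relatively closed away from \<open>a\<close>. So the traces agree near \<open>a\<close> except possibly at \<open>a\<close>.
\<close>


section \<open>Renaming of variables\<close>

text \<open>Every supremum or infimum has to be that of a definable set, and every appeal to
  o-minimality has to be backed by an actual formula. To avoid writing formulas by hand,
  \<open>def_pred\<close> and \<open>def_fun\<close> are closed under connectives, quantifiers and
  composition, so that definability can be read off the shape of a statement. As these quantifiers
  range over elements of \<open>M\<close>, points of a trace are always addressed through their
  curve parameter.

  Besides suprema, o-minimality supplies a one-sided dichotomy: just to the left of a given point, a
  definable condition holds throughout or fails throughout. It controls the end t = 1 of a curve,
  where neither continuity nor a limit is given.

  A Hausdorff distance is handled through the set of its upper bounds. Uniqueness, symmetry, the
  triangle inequality and definability then become statements about
  \<open>hausdorff_semidist_le\<close>.\<close>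

fun rename_trm :: "(nat \<Rightarrow> nat) \<Rightarrow> 'f trm \<Rightarrow> 'f trm" where
  "rename_trm \<rho> (Var i) = Var (\<rho> i)"
| "rename_trm \<rho> (Fun f ts) = Fun f (map (rename_trm \<rho>) ts)"

text \<open>Bound variables become levels \<open>n, n + 1, \<dots>\<close>, which avoids capture if \<open>\<rho>\<close> maps the
  free variables below \<open>n\<close>.\<close>

primrec rename_fm :: "nat \<Rightarrow> (nat \<Rightarrow> nat) \<Rightarrow> ('f, 'r) fm \<Rightarrow> ('f, 'r) fm" where
  "rename_fm n \<rho> (Eq s t) = Eq (rename_trm \<rho> s) (rename_trm \<rho> t)"
| "rename_fm n \<rho> (Rel r ts) = Rel r (map (rename_trm \<rho>) ts)"
| "rename_fm n \<rho> (Neg \<phi>) = Neg (rename_fm n \<rho> \<phi>)"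
| "rename_fm n \<rho> (And \<phi> \<psi>) = And (rename_fm n \<rho> \<phi>) (rename_fm n \<rho> \<psi>)"
| "rename_fm n \<rho> (All x \<phi>) = All n (rename_fm (Suc n) (\<rho>(x := n)) \<phi>)"

lemma wf_rename_trm: "wf_trm L t \<Longrightarrow> wf_trm L (rename_trm \<rho> t)"
  by (induction t) auto

lemma wf_rename_fm: "wf_fm L \<phi> \<Longrightarrow> wf_fm L (rename_fm n \<rho> \<phi>)"
  by (induction \<phi> arbitrary: n \<rho>) (auto simp: wf_rename_trm)

lemma trm_val_rename: "trm_val N e (rename_trm \<rho> t) = trm_val N (e \<circ> \<rho>) t"
  by (induction t) (auto intro!: arg_cong[where f = "fun_int N _"])

lemma trm_val_cong: "(\<And>i. i \<in> trm_vars t \<Longrightarrow> e i = e' i) \<Longrightarrow> trm_val N e t = trm_val N e' t"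
proof (induction t)
  case (Fun f ts)
  then have "map (trm_val N e) ts = map (trm_val N e') ts"
    by (intro map_cong) auto
  then show ?case by (simp only: trm_val.simps)
qed simp

lemma sat_cong: "(\<And>i. i \<in> free_vars \<phi> \<Longrightarrow> e i = e' i) \<Longrightarrow> sat N e \<phi> \<longleftrightarrow> sat N e' \<phi>"
proof (induction \<phi> arbitrary: e e')
  case (Eq s t)
  then show ?case using trm_val_cong[of s e e' N] trm_val_cong[of t e e' N] by simp
next
  case (Rel r ts)
  then have "map (trm_val N e) ts = map (trm_val N e') ts"
    by (intro map_cong trm_val_cong) auto
  then show ?case by (simp only: sat.simps)
next
  case (Neg \<phi>)
  have "sat N e \<phi> \<longleftrightarrow> sat N e' \<phi>"
    by (rule Neg.IH) (simp add: Neg.prems)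
  then show ?case by (simp only: sat.simps)
next
  case (And \<phi> \<psi>)
  have "sat N e \<phi> \<longleftrightarrow> sat N e' \<phi>" "sat N e \<psi> \<longleftrightarrow> sat N e' \<psi>"
    by (rule And.IH; simp add: And.prems)+
  then show ?case by (simp only: sat.simps)
next
  case (All x \<phi>)
  have "sat N (e(x := u)) \<phi> \<longleftrightarrow> sat N (e'(x := u)) \<phi>" for u
  proof (rule All.IH)
    show "(e(x := u)) y = (e'(x := u)) y" if "y \<in> free_vars \<phi>" for y
      using that All.prems[of y] by (cases "y = x") auto
  qed
  then show ?case by (simp only: sat.simps)
qed

lemma sat_rename:
  "(\<And>y. y \<in> free_vars \<phi> \<Longrightarrow> \<rho> y < n) \<Longrightarrow> sat N e (rename_fm n \<rho> \<phi>) \<longleftrightarrow> sat N (e \<circ> \<rho>) \<phi>"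
proof (induction \<phi> arbitrary: e n \<rho>)
  case (Eq s t)
  show ?case by (simp only: rename_fm.simps sat.simps trm_val_rename)
next
  case (Rel r ts)
  have "map (trm_val N e \<circ> rename_trm \<rho>) ts = map (trm_val N (e \<circ> \<rho>)) ts"
    by (simp add: trm_val_rename)
  then show ?case by (simp only: rename_fm.simps sat.simps map_map)
next
  case (Neg \<phi>)
  have "sat N e (rename_fm n \<rho> \<phi>) \<longleftrightarrow> sat N (e \<circ> \<rho>) \<phi>"
    by (rule Neg.IH) (simp add: Neg.prems)
  then show ?case by (simp only: rename_fm.simps sat.simps)
next
  case (And \<phi> \<psi>)
  have "sat N e (rename_fm n \<rho> \<phi>) \<longleftrightarrow> sat N (e \<circ> \<rho>) \<phi>"
    by (rule And.IH) (simp add: And.prems)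
  moreover have "sat N e (rename_fm n \<rho> \<psi>) \<longleftrightarrow> sat N (e \<circ> \<rho>) \<psi>"
    by (rule And.IH) (simp add: And.prems)
  ultimately show ?case by (simp only: rename_fm.simps sat.simps)
next
  case (All x \<phi>)
  have "sat N (e(n := u)) (rename_fm (Suc n) (\<rho>(x := n)) \<phi>) \<longleftrightarrow> sat N ((e \<circ> \<rho>)(x := u)) \<phi>" for u
  proof -
    have "sat N (e(n := u)) (rename_fm (Suc n) (\<rho>(x := n)) \<phi>) \<longleftrightarrow>
        sat N (e(n := u) \<circ> \<rho>(x := n)) \<phi>"
    proof (rule All.IH)
      show "(\<rho>(x := n)) y < Suc n" if "y \<in> free_vars \<phi>" for y
        using that All.prems[of y] by (cases "y = x") auto
    qed
    \<comment> \<open>The two environments agree only on the free variables of \<phi>: their images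
      under \<rho> lie below n, so overwriting e at n does not touch them.\<close>
    also have "\<dots> \<longleftrightarrow> sat N ((e \<circ> \<rho>)(x := u)) \<phi>"
    proof (rule sat_cong)
      show "(e(n := u) \<circ> \<rho>(x := n)) y = ((e \<circ> \<rho>)(x := u)) y" if "y \<in> free_vars \<phi>" for y
        using that All.prems[of y] by (cases "y = x") auto
    qed
    finally show ?thesis .
  qed
  then show ?case by (simp only: rename_fm.simps sat.simps)
qed

lemma finite_trm_vars: "finite (trm_vars t)"
  by (induction t) auto

lemma finite_free_vars: "finite (free_vars \<phi>)"
  by (induction \<phi>) (auto simp: finite_trm_vars)

text \<open>Only finitely many variables are free, so some level lies above all their images. Hence
  \<rho> is arbitrary; in particular it may identify variables.\<close>

lemma rename_ex:
  fixes \<phi> :: "('f, 'r) fm"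
  assumes "wf_fm L \<phi>"
  obtains \<phi>' :: "('f, 'r) fm"
  where "wf_fm L \<phi>'"
    "\<And>w. sat N w \<phi>' \<longleftrightarrow> sat N (w \<circ> \<rho>) \<phi>"
proof -
  define n where "n = Suc (Max (insert 0 (\<rho> ` free_vars \<phi>)))"
  have less: "\<rho> y < n" if "y \<in> free_vars \<phi>" for y
    using that finite_free_vars[of \<phi>] unfolding n_def less_Suc_eq_le by (intro Max_ge) auto
  show thesis
  proof (rule that)
    show "wf_fm L (rename_fm n \<rho> \<phi>)"
      by (rule wf_rename_fm[OF assms])
    show "sat N w (rename_fm n \<rho> \<phi>) \<longleftrightarrow> sat N (w \<circ> \<rho>) \<phi>" for w
      by (rule sat_rename[OF less])
  qed
qed


section \<open>Definable predicates and functions of an environment\<close>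

locale ordered_field_expansion =
  fixes L :: "('f, 'r) language" and M :: "('f, 'r, 'm::linordered_field) fo_structure"
  assumes lang: "expands_ordered_ring_language L"
    and ordered_field: "ordered_field_structure L M"
begin

lemma univ_eq [simp]: "univ M = UNIV"
  using ordered_field by (simp add: ordered_field_structure_def)

lemma assignments_eq [simp]: "assignments M = UNIV"
  by (simp add: assignments_def)

definition merge :: "(nat \<Rightarrow> 'm) \<Rightarrow> (nat \<Rightarrow> 'm) \<Rightarrow> nat \<Rightarrow> 'm" where
  "merge v e i = (if even i then v (i div 2) else e (i div 2))"

lemma div_4_add: "(4 * i + 1) div 2 = 2 * i" "(4 * i + 3) div 2 = Suc (2 * i)" for i :: nat
  by linarith+

lemma merge_even [simp]: "merge v e (2 * i) = v i"
  and merge_odd [simp]: "merge v e (Suc (2 * i)) = e i"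
  and merge_0 [simp]: "merge v e 0 = v 0"
  and merge_2 [simp]: "merge v e 2 = v (Suc 0)"
  and merge_4 [simp]: "merge v e 4 = v (Suc (Suc 0))"
  by (simp_all add: merge_def flip: numeral_2_eq_2)

text \<open>The variables of an environment sit at the even indices of a formula, its parameters at the
  odd ones, so that two definitions with different parameters can be combined.\<close>

definition def_pred :: "((nat \<Rightarrow> 'm) \<Rightarrow> bool) \<Rightarrow> bool" where
  "def_pred P \<longleftrightarrow> (\<exists>\<phi> e. wf_fm L \<phi> \<and> (\<forall>v. P v \<longleftrightarrow> sat M (merge v e) \<phi>))"

text \<open>The renaming \<rho> lets a formula be written with whatever variable numbers are
  convenient and moved to the even and odd layout afterwards.\<close>

lemma def_predI:
  assumes "wf_fm L \<phi>" and "\<And>v. P v \<longleftrightarrow> sat M (merge v e \<circ> \<rho>) \<phi>"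
  shows "def_pred P"
proof -
  obtain \<phi>' where "wf_fm L \<phi>'" and "\<And>w. sat M w \<phi>' \<longleftrightarrow> sat M (w \<circ> \<rho>) \<phi>"
    by (rule rename_ex[OF assms(1), where N = M and \<rho> = \<rho>], rule that)
  then show ?thesis
    unfolding def_pred_def by (intro exI[of _ \<phi>'] exI[of _ e]) (simp add: assms(2))
qed

lemma def_predE:
  assumes "def_pred P"
  obtains \<phi> e where "wf_fm L \<phi>" "\<And>v. P v \<longleftrightarrow> sat M (merge v e) \<phi>"
  using assms unfolding def_pred_def by blast

lemma def_pred_not: "def_pred P \<Longrightarrow> def_pred (\<lambda>v. \<not> P v)"
  by (erule def_predE) (rule def_predI[where \<phi> = "Neg _" and \<rho> = id], auto)

lemma def_pred_conj:
  assumes "def_pred P" and "def_pred Q"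
  shows "def_pred (\<lambda>v. P v \<and> Q v)"
proof -
  obtain \<phi> e where \<phi>: "wf_fm L \<phi>" "\<And>v. P v \<longleftrightarrow> sat M (merge v e) \<phi>"
    by (rule def_predE[OF assms(1)], rule that)
  obtain \<psi> e' where \<psi>: "wf_fm L \<psi>" "\<And>v. Q v \<longleftrightarrow> sat M (merge v e') \<psi>"
    by (rule def_predE[OF assms(2)], rule that)
  \<comment> \<open>In \<open>merge e e'\<close> the i-th parameter of the first formula sits in
    slot 2i and that of the second in slot 2i + 1. Since slot j has index 2j + 1 in a formula, they
    end up at 4i + 1 and 4i + 3.\<close>
  define \<rho> where "\<rho> i = (if even i then i else 4 * (i div 2) + 1)" for i :: nat
  define \<rho>' where "\<rho>' i = (if even i then i else 4 * (i div 2) + 3)" for i :: nat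
  obtain \<phi>' where \<phi>': "wf_fm L \<phi>'" "\<And>w. sat M w \<phi>' \<longleftrightarrow> sat M (w \<circ> \<rho>) \<phi>"
    by (rule rename_ex[OF \<phi>(1), where N = M and \<rho> = \<rho>], rule that)
  obtain \<psi>' where \<psi>': "wf_fm L \<psi>'" "\<And>w. sat M w \<psi>' \<longleftrightarrow> sat M (w \<circ> \<rho>') \<psi>"
    by (rule rename_ex[OF \<psi>(1), where N = M and \<rho> = \<rho>'], rule that)
  have "merge v (merge e e') \<circ> \<rho> = merge v e" "merge v (merge e e') \<circ> \<rho>' = merge v e'" for v
    by (auto simp: fun_eq_iff merge_def \<rho>_def \<rho>'_def div_4_add[unfolded One_nat_def] elim!: oddE)
  then show ?thesis
    unfolding def_pred_def
    by (intro exI[of _ "And \<phi>' \<psi>'"] exI[of _ "merge e e'"]) (simp add: \<phi>' \<psi>' \<phi> \<psi>)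
qed

text \<open>Coordinates in \<open>C\<close> are frozen to constants, which become additional
  parameters; the others are reindexed by \<open>f\<close>. This provides both constants and
  reordering of arguments.\<close>

lemma def_pred_subst:
  assumes "def_pred P"
  shows "def_pred (\<lambda>v. P (\<lambda>i. if C i then c i else v (f i)))"
proof -
  obtain \<phi> e where \<phi>: "wf_fm L \<phi>" "\<And>v. P v \<longleftrightarrow> sat M (merge v e) \<phi>"
    by (rule def_predE[OF assms(1)], rule that)
  define \<rho> where "\<rho> i = (if even i then if C (i div 2) then 4 * (i div 2) + 1 else 2 * f (i div 2)
    else 4 * (i div 2) + 3)" for i :: nat
  have "merge v (merge c e) \<circ> \<rho> = merge (\<lambda>i. if C i then c i else v (f i)) e" for v
    by (auto simp: fun_eq_iff merge_def \<rho>_def div_4_add)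
  then show ?thesis
    using \<phi> by (intro def_predI[OF \<phi>(1), of _ "merge c e" \<rho>]) simp
qed

lemma def_pred_rename: "def_pred P \<Longrightarrow> def_pred (\<lambda>v. P (\<lambda>i. v (f i)))"
  using def_pred_subst[of P "\<lambda>_. False" undefined f] by simp

text \<open>Environments follow the de Bruijn convention: the quantified element is coordinate 0 and
  the remaining coordinates move up by one.\<close>

lemma def_pred_all_case:
  assumes "def_pred P"
  shows "def_pred (\<lambda>v. \<forall>x. P (case_nat x v))"
proof -
  obtain \<phi> e where \<phi>: "wf_fm L \<phi>" "\<And>v. P v \<longleftrightarrow> sat M (merge v e) \<phi>"
    by (rule def_predE[OF assms(1)], rule that)
  \<comment> \<open>Index 1, which is parameter slot 0, is reserved for the bound variable.
    Parameters move up by one slot to make room and the remaining variables move down. The entry of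
    \<open>e'\<close> in slot 0 is overwritten by the quantifier.\<close>
  define \<rho> where "\<rho> i = (if i = 0 then 1 else if even i then i - 2 else i + 2)" for i :: nat
  obtain \<phi>' where \<phi>': "wf_fm L \<phi>'" "\<And>w. sat M w \<phi>' \<longleftrightarrow> sat M (w \<circ> \<rho>) \<phi>"
    by (rule rename_ex[OF \<phi>(1), where N = M and \<rho> = \<rho>], rule that)
  define e' where "e' = case_nat undefined e"
  have "(merge v e')(1 := u) \<circ> \<rho> = merge (case_nat u v) e" for u v
  proof
    fix i
    consider "i = 0" | j where "i = 2 * Suc j" | j where "i = Suc (2 * j)"
    proof (cases "even i")
      case True
      then show thesis using that(1,2) by (metis evenE mult_0_right not0_implies_Suc)
    next
      case False
      then show thesis using that(3) by (metis oddE Suc_eq_plus1)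
    qed
    then show "((merge v e')(1 := u) \<circ> \<rho>) i = merge (case_nat u v) e i"
    proof cases
      case 3
      then have "\<rho> i = Suc (2 * Suc j)" by (simp add: \<rho>_def)
      then show ?thesis unfolding 3 comp_def fun_upd_def by (simp del: mult_Suc_right add: e'_def)
    qed (simp_all add: \<rho>_def merge_def)
  qed
  then show ?thesis
    unfolding def_pred_def by (intro exI[of _ "All 1 \<phi>'"] exI[of _ e']) (simp add: \<phi>' \<phi>)
qed

lemma def_pred_all:
  assumes "def_pred (\<lambda>v. R (v 0) (\<lambda>i. v (Suc i)))"
  shows "def_pred (\<lambda>v. \<forall>x. R x v)"
  using def_pred_all_case[OF assms] by simp

lemma def_pred_const: "def_pred (\<lambda>_. b)"
proof -
  have t: "def_pred (\<lambda>_. True)"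
    by (rule def_predI[where \<phi> = "Eq (Var 0) (Var 0)"]) auto
  show ?thesis using t def_pred_not[OF t] by (cases b) auto
qed

lemma def_pred_disj:
  assumes "def_pred P" "def_pred Q" shows "def_pred (\<lambda>v. P v \<or> Q v)"
  using def_pred_not[OF def_pred_conj[OF assms[THEN def_pred_not]]] by simp

lemma def_pred_imp:
  assumes "def_pred P" "def_pred Q" shows "def_pred (\<lambda>v. P v \<longrightarrow> Q v)"
  unfolding imp_conv_disj by (intro def_pred_disj def_pred_not assms)

lemma def_pred_iff:
  assumes "def_pred P" "def_pred Q" shows "def_pred (\<lambda>v. P v \<longleftrightarrow> Q v)"
  unfolding iff_conv_conj_imp by (intro def_pred_conj def_pred_imp assms)

lemma def_pred_ex:
  assumes "def_pred (\<lambda>v. R (v 0) (\<lambda>i. v (Suc i)))"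
  shows "def_pred (\<lambda>v. \<exists>x. R x v)"
  using def_pred_not[OF def_pred_all[of "\<lambda>x v. \<not> R x v", OF def_pred_not[OF assms]]] by simp

lemma def_pred_ball:
  fixes n :: nat
  assumes "\<And>i. i < n \<Longrightarrow> def_pred (P i)"
  shows "def_pred (\<lambda>v. \<forall>i<n. P i v)"
  using assms
proof (induction n)
  case (Suc n)
  then show ?case using def_pred_conj[of "\<lambda>v. \<forall>i<n. P i v" "P n"]
    by (simp add: All_less_Suc conj_commute)
qed (simp add: def_pred_const)

text \<open>In the induction step the outer quantifier binds the coordinate directly behind the
  first n, so it contributes the last entry of the longer list.\<close>

lemma def_pred_ex_list:
  assumes "def_pred P"
  shows "def_pred (\<lambda>v. \<exists>xs. length xs = n \<and> P (\<lambda>i. if i < n then xs ! i else v (i - n)))"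
proof (induction n)
  case 0
  then show ?case using assms by simp
next
  case (Suc n)
  have eq: "(\<exists>x xs. length xs = n \<and> P (\<lambda>i. if i < n then xs ! i else case_nat x v (i - n))) \<longleftrightarrow>
     (\<exists>xs. length xs = Suc n \<and> P (\<lambda>i. if i < Suc n then xs ! i else v (i - Suc n)))" for v
  proof -
    have "(\<lambda>i. if i < n then xs ! i else case_nat x v (i - n)) =
       (\<lambda>i. if i < Suc n then (xs @ [x]) ! i else v (i - Suc n))" if "length xs = n" for x xs
    proof
      show "(if i < n then xs ! i else case_nat x v (i - n)) =
          (if i < Suc n then (xs @ [x]) ! i else v (i - Suc n))" for i
        using that Suc_diff_Suc[of n i] by (auto simp: nth_append less_Suc_eq split: nat.split)
    qed
    then have "(\<exists>x xs. length xs = n \<and> P (\<lambda>i. if i < n then xs ! i else case_nat x v (i - n))) \<longleftrightarrow>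
        (\<exists>x xs. length xs = n \<and> P (\<lambda>i. if i < Suc n then (xs @ [x]) ! i else v (i - Suc n)))"
      by (simp cong: conj_cong)
    also have "\<dots> \<longleftrightarrow> (\<exists>xs. length xs = Suc n \<and> P (\<lambda>i. if i < Suc n then xs ! i else v (i - Suc n)))"
      unfolding length_Suc_conv_rev by blast
    finally show ?thesis .
  qed
  have "def_pred (\<lambda>v. \<exists>x xs. length xs = n \<and> P (\<lambda>i. if i < n then xs ! i else case_nat x v (i - n)))"
  proof (rule def_pred_ex)
    have "case_nat (v 0) (\<lambda>i. v (Suc i)) i = v i" for v :: "nat \<Rightarrow> 'm" and i
      by (simp split: nat.split)
    then show "def_pred (\<lambda>v. \<exists>xs. length xs = n \<and>
        P (\<lambda>i. if i < n then xs ! i else case_nat (v 0) (\<lambda>i. v (Suc i)) (i - n)))"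
      using Suc by (simp only:)
  qed
  then show ?case unfolding eq .
qed

text \<open>Definability of the graph, with the value in coordinate 0 and the arguments behind it.
  This placement makes the value the variable that \<open>def_pred_ex\<close> eliminates when
  functions are composed.\<close>

definition def_fun :: "((nat \<Rightarrow> 'm) \<Rightarrow> 'm) \<Rightarrow> bool" where
  "def_fun F \<longleftrightarrow> def_pred (\<lambda>v. v 0 = F (\<lambda>i. v (Suc i)))"

lemma def_pred_var_eq: "def_pred (\<lambda>v. v i = v j)"
  by (rule def_predI[where \<phi> = "Eq (Var i) (Var j)" and \<rho> = "\<lambda>i. 2 * i"]) auto

lemma def_fun_var: "def_fun (\<lambda>v. v i)"
  unfolding def_fun_def by (rule def_pred_var_eq)

lemma def_fun_const: "def_fun (\<lambda>_. c)"
  unfolding def_fun_def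
  using def_pred_subst[OF def_pred_var_eq[of 0 1], of "\<lambda>i. i = 1" "\<lambda>_. c" id] by simp

lemma def_fun_rename: "def_fun F \<Longrightarrow> def_pred (\<lambda>v. v j = F (\<lambda>i. v (f i)))"
  unfolding def_fun_def by (drule def_pred_rename[of _ "case_nat j f"]) simp

text \<open>Terms for F need not exist in the language, so substitution goes through the graph: some
  x equals \<open>F v\<close> and satisfies R.\<close>

lemma def_pred_comp:
  assumes "def_fun F" and "def_pred (\<lambda>v. R (v 0) (\<lambda>i. v (Suc i)))"
  shows "def_pred (\<lambda>v. R (F v) v)"
proof -
  have "def_pred (\<lambda>v. v 0 = F (\<lambda>i. v (Suc i)) \<and> R (v 0) (\<lambda>i. v (Suc i)))"
    by (rule def_pred_conj[OF assms(1)[unfolded def_fun_def] assms(2)])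
  then have "def_pred (\<lambda>v. \<exists>x. x = F v \<and> R x v)"
    by (rule def_pred_ex)
  then show ?thesis by simp
qed

lemma def_pred_comp1:
  assumes "def_pred (\<lambda>v. R (v 0))" "def_fun F"
  shows "def_pred (\<lambda>v. R (F v))"
  using assms(2,1) by (rule def_pred_comp)

lemma def_pred_comp2:
  assumes "def_pred (\<lambda>v. R (v 0) (v 1))" "def_fun F" "def_fun G"
  shows "def_pred (\<lambda>v. R (F v) (G v))"
proof (rule def_pred_comp[OF assms(2)])
  have "def_fun (\<lambda>v. G (\<lambda>i. v (Suc i)))"
    unfolding def_fun_def by (rule def_fun_rename[OF assms(3)])
  moreover have "def_pred (\<lambda>v. R (v (Suc 0)) (v 0))"
    using def_pred_rename[OF assms(1), of "\<lambda>i. if i = 0 then 1 else 0"] by simp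
  ultimately show "def_pred (\<lambda>v. R (v 0) (G (\<lambda>i. v (Suc i))))"
    by (rule def_pred_comp)
qed

lemma def_fun_comp1:
  assumes "def_fun (\<lambda>v. h (v 0))" "def_fun F"
  shows "def_fun (\<lambda>v. h (F v))"
  unfolding def_fun_def
proof (rule def_pred_comp[where F = "\<lambda>v. F (\<lambda>i. v (Suc i))" and R = "\<lambda>x v. v 0 = h x"])
  show "def_fun (\<lambda>v. F (\<lambda>i. v (Suc i)))"
    unfolding def_fun_def by (rule def_fun_rename[OF assms(2)])
  show "def_pred (\<lambda>v. v (Suc 0) = h (v 0))"
    using def_fun_rename[OF assms(1), of "Suc 0" "\<lambda>i. i"] .
qed

lemma def_fun_comp2:
  assumes "def_fun (\<lambda>v. h (v 0) (v 1))" "def_fun F" "def_fun G"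
  shows "def_fun (\<lambda>v. h (F v) (G v))"
  unfolding def_fun_def
proof (rule def_pred_comp[where F = "\<lambda>v. F (\<lambda>i. v (Suc i))"
      and R = "\<lambda>x v. v 0 = h x (G (\<lambda>i. v (Suc i)))"])
  show "def_fun (\<lambda>v. F (\<lambda>i. v (Suc i)))"
    unfolding def_fun_def by (rule def_fun_rename[OF assms(2)])
  show "def_pred (\<lambda>v. v (Suc 0) = h (v 0) (G (\<lambda>i. v (Suc (Suc i)))))"
  proof (rule def_pred_comp[where F = "\<lambda>v. G (\<lambda>i. v (Suc (Suc i)))"
        and R = "\<lambda>x v. v (Suc 0) = h (v 0) x"])
    show "def_fun (\<lambda>v. G (\<lambda>i. v (Suc (Suc i))))"
      unfolding def_fun_def by (rule def_fun_rename[OF assms(3)])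
    show "def_pred (\<lambda>v. v (Suc (Suc 0)) = h (v (Suc 0)) (v 0))"
      using def_fun_rename[OF assms(1), of "Suc (Suc 0)" "\<lambda>i. if i = 0 then 1 else 0"] by simp
  qed
qed

lemmas lang_defs = lang[unfolded expands_ordered_ring_language_def]
  and ordered_field_defs = ordered_field[unfolded ordered_field_structure_def]

lemma def_pred_eq: "def_fun F \<Longrightarrow> def_fun G \<Longrightarrow> def_pred (\<lambda>v. F v = G v)"
  by (rule def_pred_comp2[where R = "(=)"]) (rule def_pred_var_eq)

lemma def_pred_less:
  assumes "def_fun F" "def_fun G" shows "def_pred (\<lambda>v. F v < G v)"
proof (rule def_pred_comp2[OF _ assms])
  show "def_pred (\<lambda>v. v 0 < v 1)"
    by (rule def_predI[where \<phi> = "Rel (less_sym L) [Var 0, Var 1]" and \<rho> = "\<lambda>i. 2 * i"])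
      (use lang_defs ordered_field_defs in auto)
qed

lemma def_pred_le:
  assumes "def_fun F" "def_fun G" shows "def_pred (\<lambda>v. F v \<le> G v)"
  using def_pred_not[OF def_pred_less[OF assms(2,1)]] by (simp add: not_less)

lemma def_fun_add:
  assumes "def_fun F" "def_fun G" shows "def_fun (\<lambda>v. F v + G v)"
proof (rule def_fun_comp2[OF _ assms])
  show "def_fun (\<lambda>v. v 0 + v 1)"
    unfolding def_fun_def
    by (rule def_predI[where \<phi> = "Eq (Var 0) (Fun (plus_sym L) [Var 1, Var 2])" and \<rho> = "\<lambda>i. 2 * i"])
      (use lang_defs ordered_field_defs in auto)
qed

lemma def_fun_minus:
  assumes "def_fun F" shows "def_fun (\<lambda>v. - F v)"
proof (rule def_fun_comp1[OF _ assms])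
  show "def_fun (\<lambda>v. - v 0)"
    unfolding def_fun_def
    by (rule def_predI[where \<phi> = "Eq (Var 0) (Fun (minus_sym L) [Var 1])" and \<rho> = "\<lambda>i. 2 * i"])
      (use lang_defs ordered_field_defs in auto)
qed

lemma def_fun_diff: "def_fun F \<Longrightarrow> def_fun G \<Longrightarrow> def_fun (\<lambda>v. F v - G v)"
  using def_fun_add[of F "\<lambda>v. - G v"] def_fun_minus[of G] by simp

lemma def_fun_if:
  assumes "def_pred P" "def_fun F" "def_fun G"
  shows "def_fun (\<lambda>v. if P v then F v else G v)"
proof -
  have eq: "v 0 = (if P (\<lambda>i. v (Suc i)) then F (\<lambda>i. v (Suc i)) else G (\<lambda>i. v (Suc i))) \<longleftrightarrow>
      (P (\<lambda>i. v (Suc i)) \<longrightarrow> v 0 = F (\<lambda>i. v (Suc i))) \<and>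
      (\<not> P (\<lambda>i. v (Suc i)) \<longrightarrow> v 0 = G (\<lambda>i. v (Suc i)))" for v
    by simp
  show ?thesis
    unfolding def_fun_def eq
    by (intro def_pred_conj def_pred_imp def_pred_not def_pred_rename[OF assms(1)]
        assms(2,3)[unfolded def_fun_def])
qed

lemma def_fun_abs: "def_fun F \<Longrightarrow> def_fun (\<lambda>v. \<bar>F v\<bar>)"
  unfolding abs_if by (intro def_fun_if def_pred_less def_fun_const def_fun_minus)

lemmas def_intros = def_pred_not def_pred_conj def_pred_disj def_pred_imp def_pred_iff def_pred_all
  def_pred_ex def_pred_eq def_pred_less def_pred_le def_pred_const
  def_fun_var def_fun_const def_fun_add def_fun_minus def_fun_diff def_fun_if def_fun_abs

section \<open>Passage between definable sets of lists and definable predicates\<close>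

lemma definable_def_pred:
  assumes "definable L M n S"
  shows "def_pred (\<lambda>v. map v [0..<n] \<in> S)"
proof -
  obtain \<phi> e where \<phi>: "wf_fm L \<phi>" and
    S: "S = {xs. length xs = n \<and> sat M (\<lambda>i. if i < n then xs ! i else e i) \<phi>}"
    using assms by (auto simp: definable_def)
  show ?thesis
  proof (rule def_predI[OF \<phi>, where e = e and \<rho> = "\<lambda>i. if i < n then 2 * i else Suc (2 * i)"])
    fix v
    have "merge v e \<circ> (\<lambda>i. if i < n then 2 * i else Suc (2 * i)) =
        (\<lambda>i. if i < n then map v [0..<n] ! i else e i)"
      by (auto simp: fun_eq_iff)
    then show "(map v [0..<n] \<in> S) \<longleftrightarrow>
        sat M (merge v e \<circ> (\<lambda>i. if i < n then 2 * i else Suc (2 * i))) \<phi>"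
      by (simp add: S)
  qed
qed

lemma def_pred_definable:
  assumes "def_pred P" and "\<And>v w. (\<And>i. i < n \<Longrightarrow> v i = w i) \<Longrightarrow> P v \<longleftrightarrow> P w"
  shows "definable L M n {xs. length xs = n \<and> P (\<lambda>i. xs ! i)}"
proof -
  obtain \<phi> e where \<phi>: "wf_fm L \<phi>" "\<And>v. P v \<longleftrightarrow> sat M (merge v e) \<phi>"
    by (rule def_predE[OF assms(1)], rule that)
  \<comment> \<open>All variables beyond the first n are sent to the dummy index n, where the
    assignment is 0; P does not depend on them. The parameters follow from n + 1 on.\<close>
  define \<rho> where "\<rho> i = (if even i then if i div 2 < n then i div 2 else n else n + Suc (i div 2))"
    for i :: nat
  obtain \<phi>' where \<phi>': "wf_fm L \<phi>'" "\<And>w. sat M w \<phi>' \<longleftrightarrow> sat M (w \<circ> \<rho>) \<phi>"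
    by (rule rename_ex[OF \<phi>(1), where N = M and \<rho> = \<rho>], rule that)
  define e' where "e' i = (if i = n then 0 else e (i - Suc n))" for i
  have "P (\<lambda>i. xs ! i) \<longleftrightarrow> sat M (\<lambda>i. if i < n then xs ! i else e' i) \<phi>'" for xs
  proof -
    have "(\<lambda>i. if i < n then xs ! i else e' i) \<circ> \<rho> = merge (\<lambda>i. if i < n then xs ! i else 0) e"
      by (auto simp: fun_eq_iff \<rho>_def e'_def merge_def)
    moreover have "P (\<lambda>i. xs ! i) \<longleftrightarrow> P (\<lambda>i. if i < n then xs ! i else 0)"
      by (rule assms(2)) simp
    ultimately show ?thesis using \<phi>(2) \<phi>'(2) by simp
  qed
  then show ?thesis
    unfolding definable_def using \<phi>'(1) by (intro exI[of _ \<phi>'] conjI bexI[of _ e']) auto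
qed

lemma definable_fun_iff: "definable_fun L M f \<longleftrightarrow> def_fun (\<lambda>v. f (v 0))"
proof
  assume "definable_fun L M f"
  then have "def_pred (\<lambda>v. map v [0..<2] \<in> {[t, f t] | t. True})"
    unfolding definable_fun_def by (rule definable_def_pred)
  then have "def_pred (\<lambda>v. v 1 = f (v 0))"
    by (simp add: upt_rec numeral_2_eq_2)
  then show "def_fun (\<lambda>v. f (v 0))"
    using def_pred_rename[of _ "\<lambda>i. if i = 0 then 1 else 0"] unfolding def_fun_def by fastforce
next
  assume "def_fun (\<lambda>v. f (v 0))"
  then have "def_pred (\<lambda>v. v 1 = f (v 0))"
    by (rule def_fun_rename)
  then have "definable L M 2 {xs. length xs = 2 \<and> xs ! 1 = f (xs ! 0)}"
    by (rule def_pred_definable) simp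
  moreover have "{xs. length xs = 2 \<and> xs ! 1 = f (xs ! 0)} = {[t, f t] | t. True}"
    by (auto simp: length_Suc_conv numeral_2_eq_2)
  ultimately show "definable_fun L M f"
    by (simp add: definable_fun_def)
qed

lemma def_pred_definable_set:
  assumes "def_pred (\<lambda>v. P (v 0))"
  shows "definable L M 1 {[x] | x. P x}"
proof -
  have "definable L M 1 {xs. length xs = 1 \<and> P (xs ! 0)}"
    by (rule def_pred_definable[OF assms]) simp
  moreover have "{xs. length xs = 1 \<and> P (xs ! 0)} = {[x] | x. P x}"
    by (auto simp: length_Suc_conv)
  ultimately show ?thesis by simp
qed

end


section \<open>Transfer of o-minimality\<close>

text \<open>Properties of a theory quantify over structures on a fixed type that differs from the
  type of M. A copy of M along an injection h with left inverse g makes M accessible to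
  them.\<close>

definition structure_image ::
    "('u \<Rightarrow> 'w) \<Rightarrow> ('w \<Rightarrow> 'u) \<Rightarrow> ('f, 'r, 'u) fo_structure \<Rightarrow> ('f, 'r, 'w) fo_structure" where
  "structure_image h g N =
     \<lparr>univ = h ` univ N, fun_int = (\<lambda>f xs. h (fun_int N f (map g xs))),
      rel_int = (\<lambda>r xs. rel_int N r (map g xs))\<rparr>"

locale structure_copy =
  fixes h :: "'u \<Rightarrow> 'w" and g :: "'w \<Rightarrow> 'u" and N :: "('f, 'r, 'u) fo_structure"
    and L :: "('f, 'r) language"
  assumes gh [simp]: "\<And>x. g (h x) = x"
begin

lemma h_eq_iff [simp]: "h x = h y \<longleftrightarrow> x = y"
  by (metis gh)

lemma univ_structure_image [simp]: "univ (structure_image h g N) = h ` univ N"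
  by (simp add: structure_image_def)

lemma trm_val_structure_image:
  assumes "\<And>i. e' i = h (e i)"
  shows "trm_val (structure_image h g N) e' t = h (trm_val N e t)"
proof (induction t)
  case (Fun f ts)
  have "map g (map (trm_val (structure_image h g N) e') ts) = map (trm_val N e) ts"
    using Fun by simp
  then have "fun_int N f (map g (map (trm_val (structure_image h g N) e') ts)) =
      fun_int N f (map (trm_val N e) ts)"
    by (rule arg_cong)
  moreover have "fun_int (structure_image h g N) f xs = h (fun_int N f (map g xs))" for xs
    by (simp add: structure_image_def)
  ultimately show ?case by (simp only: trm_val.simps)
qed (simp add: assms)

lemma sat_structure_image:
  "(\<And>i. e' i = h (e i)) \<Longrightarrow> sat (structure_image h g N) e' \<phi> \<longleftrightarrow> sat N e \<phi>"
proof (induction \<phi> arbitrary: e e')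
  case (Eq s t)
  show ?case by (simp only: sat.simps trm_val_structure_image[OF Eq] h_eq_iff)
next
  case (Rel r ts)
  have "map g (map (trm_val (structure_image h g N) e') ts) = map (trm_val N e) ts"
    using trm_val_structure_image[OF Rel] by simp
  moreover have "rel_int (structure_image h g N) r xs = rel_int N r (map g xs)" for xs
    by (simp add: structure_image_def)
  ultimately show ?case by (simp only: sat.simps)
next
  case (Neg \<phi>)
  show ?case by (simp only: sat.simps Neg.IH[OF Neg.prems])
next
  case (And \<phi> \<psi>)
  show ?case by (simp only: sat.simps And.IH(1)[OF And.prems] And.IH(2)[OF And.prems])
next
  case (All x \<phi>)
  have "sat (structure_image h g N) (e'(x := h u)) \<phi> \<longleftrightarrow> sat N (e(x := u)) \<phi>" for u
    by (rule All.IH) (simp add: All.prems)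
  then show ?case by (simp only: sat.simps univ_structure_image ball_simps)
qed

lemma assignments_structure_image:
  assumes "e \<in> assignments (structure_image h g N)"
  obtains e' where "e' \<in> assignments N" "\<And>i. e i = h (e' i)"
proof (rule that)
  have e: "\<exists>x\<in>univ N. e i = h x" for i
    using assms by (auto simp: assignments_def)
  show "(\<lambda>i. g (e i)) \<in> assignments N"
    unfolding assignments_def using e by (auto; metis gh)
  show "e i = h (g (e i))" for i
    using e[of i] by auto
qed

lemma models_structure_image:
  assumes "models L N T" shows "models L (structure_image h g N) T"
proof -
  have "fun_int (structure_image h g N) f xs \<in> h ` univ N"
    if "length xs = fun_arity L f" "set xs \<subseteq> h ` univ N" for f xs
  proof -
    have "set (map g xs) \<subseteq> univ N"
      using that(2) by auto
    then have "fun_int N f (map g xs) \<in> univ N"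
      using assms that(1) unfolding models_def is_structure_def by (metis length_map)
    then show ?thesis by (simp add: structure_image_def)
  qed
  then have "is_structure L (structure_image h g N)"
    using assms by (auto simp: models_def is_structure_def)
  moreover have "sat (structure_image h g N) e \<phi>"
    if \<phi>: "\<phi> \<in> T" and e: "e \<in> assignments (structure_image h g N)" for \<phi> e
  proof -
    obtain e' where "e' \<in> assignments N" "\<And>i. e i = h (e' i)"
      by (rule assignments_structure_image[OF e], rule that)
    then show ?thesis
      using assms \<phi> sat_structure_image[of e e'] by (simp add: models_def)
  qed
  ultimately show ?thesis
    by (simp add: models_def)
qed

lemma definable_structure_image:
  assumes "definable L N n S" shows "definable L (structure_image h g N) n (map h ` S)"
proof -
  obtain \<phi> e where \<phi>: "wf_fm L \<phi>" "e \<in> assignments N" and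
    S: "S = {xs. length xs = n \<and> set xs \<subseteq> univ N \<and> sat N (\<lambda>i. if i < n then xs ! i else e i) \<phi>}"
    using assms unfolding definable_def by blast
  have sat: "sat (structure_image h g N) (\<lambda>i. if i < n then map h xs ! i else h (e i)) \<phi> \<longleftrightarrow>
      sat N (\<lambda>i. if i < n then xs ! i else e i) \<phi>" if "length xs = n" for xs
    by (rule sat_structure_image) (simp add: that)
  have "map h ` S = {ys. length ys = n \<and> set ys \<subseteq> h ` univ N \<and>
      sat (structure_image h g N) (\<lambda>i. if i < n then ys ! i else h (e i)) \<phi>}" (is "_ = ?R")
  proof (intro subset_antisym subsetI)
    fix ys assume "ys \<in> map h ` S"
    then obtain xs where xs: "xs \<in> S" "ys = map h xs" by blast
    then show "ys \<in> ?R" using sat[of xs] by (auto simp: S)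
  next
    fix ys assume ys: "ys \<in> ?R"
    then have eq: "map h (map g ys) = ys"
      by (auto intro!: map_idI)
    moreover have "map g ys \<in> S"
      using ys sat[of "map g ys"] unfolding eq by (auto simp: S)
    ultimately show "ys \<in> map h ` S" by (metis image_eqI)
  qed
  moreover have "(\<lambda>i. h (e i)) \<in> assignments (structure_image h g N)"
    using \<phi>(2) by (auto simp: assignments_def)
  ultimately show ?thesis
    unfolding definable_def using \<phi>(1) by (intro exI[of _ \<phi>] conjI bexI[of _ "\<lambda>i. h (e i)"]) auto
qed

lemma interval_structure_image:
  assumes "point_or_open_interval L (structure_image h g N) I"
  shows "point_or_open_interval L N (h -` I)"
proof -
  have less: "less_in L (structure_image h g N) (h x) (h y) \<longleftrightarrow> less_in L N x y" for x y
    by (simp add: less_in_def structure_image_def)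
  have vimage: "h -` {z \<in> h ` univ N. P z} = {z \<in> univ N. P (h z)}" for P
    by auto
  have point: "h -` {h c} = {c}" for c
    by auto
  have univ: "h -` h ` univ N = univ N"
    by auto
  from assms show ?thesis
    by cases (auto simp only: vimage point less univ univ_structure_image intro: point_or_open_interval.intros)
qed

text \<open>Definable sets are pushed forward along h, decomposed in the copy, and the resulting
  intervals are pulled back.\<close>

lemma o_minimal_structure_image:
  assumes "o_minimal L (structure_image h g N)" shows "o_minimal L N"
  unfolding o_minimal_def
proof (intro allI impI)
  fix S assume "definable L N 1 S"
  then obtain \<I> where \<I>: "finite \<I>" "\<And>I. I \<in> \<I> \<Longrightarrow> point_or_open_interval L (structure_image h g N) I"
    "{y. [y] \<in> map h ` S} = \<Union>\<I>"
    using assms definable_structure_image unfolding o_minimal_def by meson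
  have "[h x] \<in> map h ` S \<longleftrightarrow> [x] \<in> S" for x
    by (auto simp: image_iff Cons_eq_map_conv intro: bexI[of _ "[x]"])
  then have "{x. [x] \<in> S} = h -` {y. [y] \<in> map h ` S}"
    by simp
  also have "\<dots> = \<Union>((\<lambda>I. h -` I) ` \<I>)"
    unfolding \<I>(3) by blast
  finally have "{x. [x] \<in> S} = \<Union>((\<lambda>I. h -` I) ` \<I>)" .
  then show "\<exists>\<I>. finite \<I> \<and> (\<forall>I\<in>\<I>. point_or_open_interval L N I) \<and> {x. [x] \<in> S} = \<Union>\<I>"
    using \<I>(1,2) interval_structure_image by (intro exI[of _ "(\<lambda>I. h -` I) ` \<I>"]) auto
qed

end


section \<open>Definable completeness\<close>

locale o_minimal_expansion = ordered_field_expansion L M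
  for L :: "('f, 'r) language" and M :: "('f, 'r, 'm::linordered_field) fo_structure" +
  assumes o_minimal: "o_minimal L M"
begin

lemma less_in_iff [simp]: "less_in L M x y \<longleftrightarrow> x < y"
  using ordered_field_defs by (simp add: less_in_def)

lemma def_pred_intervals:
  assumes "def_pred (\<lambda>v. P (v 0))"
  obtains \<I> where "finite \<I>" "\<And>I. I \<in> \<I> \<Longrightarrow> point_or_open_interval L M I" "Collect P = \<Union>\<I>"
proof -
  have eq: "{x. [x] \<in> {[x] | x. P x}} = Collect P"
    by simp
  have "\<exists>\<I>. finite \<I> \<and> (\<forall>I\<in>\<I>. point_or_open_interval L M I) \<and> Collect P = \<Union>\<I>"
    using o_minimal[unfolded o_minimal_def, rule_format, OF def_pred_definable_set[OF assms]]
    unfolding eq .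
  then show thesis
    by (elim exE conjE) (rule that; blast)
qed

text \<open>The supremum is expressed by the set of all upper bounds. In this form the maximum of
  two suprema is immediately the supremum of the union.\<close>

lemma interval_lub:
  assumes "point_or_open_interval L M I" "I \<noteq> {}" "\<And>x. x \<in> I \<Longrightarrow> x \<le> b"
  shows "\<exists>u. \<forall>v. (\<forall>x\<in>I. x \<le> v) \<longleftrightarrow> u \<le> v"
  using assms(1)
proof cases
  case (1 c)
  then show ?thesis by (intro exI[of _ c]) simp
next
  case (2 c d)
  then have "c < d" using assms(2) by auto
  have "(\<forall>x\<in>I. x \<le> v) \<longleftrightarrow> d \<le> v" for v
  proof
    assume v: "\<forall>x\<in>I. x \<le> v"
    have "x \<le> v" if "c < x" "x < d" for x using that v 2 by simp
    then show "d \<le> v" using \<open>c < d\<close> by (rule dense_le_bounded[rotated])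
  qed (use 2 in auto)
  then show ?thesis by (intro exI[of _ d] allI)
next
  case (3 c)
  \<comment> \<open>A point of the ray above b contradicts that b is an upper bound.\<close>
  define y where "y = max b c + 1"
  have "max b c < y" by (simp add: y_def)
  then have "c < y" "b < y" by simp_all
  then have "y \<in> I" using 3 by simp
  then show ?thesis using assms(3)[of y] \<open>b < y\<close> by simp
next
  case (4 d)
  have "(\<forall>x\<in>I. x \<le> v) \<longleftrightarrow> d \<le> v" for v
  proof
    assume v: "\<forall>x\<in>I. x \<le> v"
    show "d \<le> v" by (rule dense_le) (use v 4 in simp)
  qed (use 4 in auto)
  then show ?thesis by (intro exI[of _ d] allI)
next
  case 5
  then show ?thesis using assms(3)[of "b + 1"] by simp
qed

lemma finite_Union_lub:
  assumes "finite \<I>" "\<And>I. I \<in> \<I> \<Longrightarrow> point_or_open_interval L M I"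
    "\<Union>\<I> \<noteq> {}" "\<And>x. x \<in> \<Union>\<I> \<Longrightarrow> x \<le> b"
  shows "\<exists>u. \<forall>v. (\<forall>x\<in>\<Union>\<I>. x \<le> v) \<longleftrightarrow> u \<le> v"
  using assms
proof (induction \<I> rule: finite_induct)
  case (insert I \<I>)
  have I: "\<exists>u. \<forall>v. (\<forall>x\<in>I. x \<le> v) \<longleftrightarrow> u \<le> v" if "I \<noteq> {}"
    by (rule interval_lub[OF insert.prems(1) that, of b, OF _ insert.prems(3)]) blast+
  have \<I>: "\<exists>u. \<forall>v. (\<forall>x\<in>\<Union>\<I>. x \<le> v) \<longleftrightarrow> u \<le> v" if "\<Union>\<I> \<noteq> {}"
    by (rule insert.IH[OF insert.prems(1) that insert.prems(3)]) blast+
  consider "I = {}" | "\<Union>\<I> = {}" | "I \<noteq> {}" "\<Union>\<I> \<noteq> {}"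
    by blast
  then show ?case
  proof cases
    case 1
    then have eq: "\<Union>(insert I \<I>) = \<Union>\<I>" by blast
    show ?thesis using insert.prems(2) unfolding eq by (rule \<I>)
  next
    case 2
    then have eq: "\<Union>(insert I \<I>) = I" by blast
    show ?thesis using insert.prems(2) unfolding eq by (rule I)
  next
    case 3
    obtain u where u: "\<forall>v. (\<forall>x\<in>I. x \<le> v) \<longleftrightarrow> u \<le> v"
      using I[OF 3(1)] ..
    obtain u' where u': "\<forall>v. (\<forall>x\<in>\<Union>\<I>. x \<le> v) \<longleftrightarrow> u' \<le> v"
      using \<I>[OF 3(2)] ..
    have "(\<forall>x\<in>\<Union>(insert I \<I>). x \<le> v) \<longleftrightarrow> max u u' \<le> v" for v
    proof -
      have "(\<forall>x\<in>\<Union>(insert I \<I>). x \<le> v) \<longleftrightarrow> (\<forall>x\<in>I. x \<le> v) \<and> (\<forall>x\<in>\<Union>\<I>. x \<le> v)"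
        by (simp only: Union_insert ball_Un)
      also have "\<dots> \<longleftrightarrow> max u u' \<le> v"
        unfolding u[THEN spec] u'[THEN spec] max.bounded_iff ..
      finally show ?thesis .
    qed
    then show ?thesis by (intro exI[of _ "max u u'"] allI)
  qed
qed simp

text \<open>The substitute for completeness of the reals: a finite union of points and intervals
  that is nonempty and bounded above inherits a supremum from its nonempty pieces.\<close>

lemma definable_lub:
  assumes "def_pred (\<lambda>v. P (v 0))" "P c" "\<And>x. P x \<Longrightarrow> x \<le> b"
  obtains u where "\<And>v. (\<forall>x. P x \<longrightarrow> x \<le> v) \<longleftrightarrow> u \<le> v"
proof -
  obtain \<I> where \<I>: "finite \<I>" "\<And>I. I \<in> \<I> \<Longrightarrow> point_or_open_interval L M I" "Collect P = \<Union>\<I>"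
    by (rule def_pred_intervals[OF assms(1)], rule that)
  have "\<exists>u. \<forall>v. (\<forall>x\<in>Collect P. x \<le> v) \<longleftrightarrow> u \<le> v"
    unfolding \<I>(3)
  proof (rule finite_Union_lub[OF \<I>(1,2)])
    show "\<Union>\<I> \<noteq> {}"
      using assms(2) unfolding \<I>(3)[symmetric] by auto
    show "x \<le> b" if "x \<in> \<Union>\<I>" for x
      using that assms(3) unfolding \<I>(3)[symmetric] by simp
  qed
  then obtain u where u: "\<forall>v. (\<forall>x\<in>Collect P. x \<le> v) \<longleftrightarrow> u \<le> v" ..
  show thesis
    by (rule that[of u]) (simp only: u[rule_format, symmetric] Ball_def mem_Collect_eq)
qed

lemma definable_glb:
  assumes "def_pred (\<lambda>v. P (v 0))" "P c" "\<And>x. P x \<Longrightarrow> b \<le> x"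
  obtains u where "\<And>v. (\<forall>x. P x \<longrightarrow> v \<le> x) \<longleftrightarrow> v \<le> u"
proof -
  have "def_pred (\<lambda>v. P (- v 0))"
    by (rule def_pred_comp1[OF assms(1)]) (intro def_intros)
  moreover have "P (- (- c))"
    using assms(2) by simp
  ultimately obtain u where u: "\<And>v. (\<forall>x. P (- x) \<longrightarrow> x \<le> v) \<longleftrightarrow> u \<le> v"
  proof (rule definable_lub[of "\<lambda>x. P (- x)" "- c" "- b"])
    show "x \<le> - b" if "P (- x)" for x
      using assms(3)[OF that] by (subst le_minus_iff)
  qed (rule that)
  have "(\<forall>x. P x \<longrightarrow> v \<le> x) \<longleftrightarrow> v \<le> - u" for v
  proof -
    have "(\<forall>x. P x \<longrightarrow> v \<le> x) \<longleftrightarrow> (\<forall>x. P (- x) \<longrightarrow> x \<le> - v)"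
    proof (intro iffI allI impI)
      show "x \<le> - v" if "\<forall>x. P x \<longrightarrow> v \<le> x" "P (- x)" for x
        using that by (subst le_minus_iff) blast
      show "v \<le> x" if "\<forall>x. P (- x) \<longrightarrow> x \<le> - v" "P x" for x
        using that(1)[rule_format, of "- x"] that(2) by simp
    qed
    also have "\<dots> \<longleftrightarrow> v \<le> - u"
      unfolding u by (rule le_minus_iff)
    finally show ?thesis .
  qed
  then show thesis by (rule that)
qed

section \<open>Behaviour of a definable set just to the left of a point\<close>

lemma interval_left_germ:
  assumes "point_or_open_interval L M I"
  shows "\<exists>c<b. (\<forall>s. c < s \<and> s < b \<longrightarrow> s \<in> I) \<or> (\<forall>s. c < s \<and> s < b \<longrightarrow> s \<notin> I)"
proof -
  have inside: ?thesis if "c < b" "\<And>s. c < s \<Longrightarrow> s < b \<Longrightarrow> s \<in> I" for c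
    using that by blast
  have outside: ?thesis if "c < b" "\<And>s. c < s \<Longrightarrow> s < b \<Longrightarrow> s \<notin> I" for c
    using that by blast
  have lt: "b - 1 < b" by simp
  show ?thesis
    using assms
  proof cases
    case (1 c)
    show ?thesis
    proof (cases "c < b")
      case True
      then show ?thesis using 1 by (intro outside[of c]) simp_all
    next
      case False
      then show ?thesis using 1 by (intro outside[OF lt]) simp
    qed
  next
    case I: (2 c d)
    consider "c < b" "b \<le> d" | "d < b" | "b \<le> c" by force
    then show ?thesis
    proof cases
      case 1
      then show ?thesis using I by (intro inside[of c]) simp_all
    next
      case 2
      then show ?thesis using I by (intro outside[of d]) simp_all
    next
      case 3
      then show ?thesis using I by (intro outside[OF lt]) simp
    qed
  next
    case (3 c)
    show ?thesis
    proof (cases "c < b")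
      case True
      then show ?thesis using 3 by (intro inside[of c]) simp_all
    next
      case False
      then show ?thesis using 3 by (intro outside[OF lt]) simp
    qed
  next
    case (4 d)
    show ?thesis
    proof (cases "d < b")
      case True
      then show ?thesis using 4 by (intro outside[of d]) simp_all
    next
      case False
      then show ?thesis using 4 by (intro inside[OF lt]) simp
    qed
  next
    case 5
    then show ?thesis by (intro inside[OF lt]) simp
  qed
qed

lemma finite_Union_left_germ:
  assumes "finite \<I>" "\<And>I. I \<in> \<I> \<Longrightarrow> point_or_open_interval L M I"
  shows "\<exists>c<b. (\<forall>s. c < s \<and> s < b \<longrightarrow> s \<in> \<Union>\<I>) \<or> (\<forall>s. c < s \<and> s < b \<longrightarrow> s \<notin> \<Union>\<I>)"
  using assms
proof (induction \<I> rule: finite_induct)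
  case empty
  have "b - 1 < b" by simp
  then show ?case by blast
next
  case (insert I \<I>)
  obtain c where c: "c < b" "(\<forall>s. c < s \<and> s < b \<longrightarrow> s \<in> I) \<or> (\<forall>s. c < s \<and> s < b \<longrightarrow> s \<notin> I)"
    using interval_left_germ[of I] insert.prems by blast
  obtain d where d: "d < b"
    "(\<forall>s. d < s \<and> s < b \<longrightarrow> s \<in> \<Union>\<I>) \<or> (\<forall>s. d < s \<and> s < b \<longrightarrow> s \<notin> \<Union>\<I>)"
    using insert.IH insert.prems by blast
  show ?case
    using c d by (intro exI[of _ "max c d"]) auto
qed

text \<open>A finite union of intervals cannot oscillate: each piece contains or avoids a whole
  interval ending at b, and so does their union.\<close>

lemma definable_left_germ:
  assumes "def_pred (\<lambda>v. P (v 0))"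
  obtains c where "c < b" "(\<forall>s. c < s \<and> s < b \<longrightarrow> P s) \<or> (\<forall>s. c < s \<and> s < b \<longrightarrow> \<not> P s)"
proof -
  obtain \<I> where \<I>: "finite \<I>" "\<And>I. I \<in> \<I> \<Longrightarrow> point_or_open_interval L M I" "Collect P = \<Union>\<I>"
    by (rule def_pred_intervals[OF assms(1)], rule that)
  show thesis
    using that finite_Union_left_germ[OF \<I>(1,2), of b] unfolding \<I>(3)[symmetric] mem_Collect_eq
    by blast
qed

end


section \<open>The sup metric and Hausdorff distances\<close>

lemma finite_sup_dist: "finite {\<bar>x ! i - y ! i\<bar> | i. i < length (x :: 'a::linordered_field list)}"
  by simp

text \<open>The conjunct \<open>0 < r\<close> stems from the 0 inserted into the maximum, which also
  gives the empty list its distance. The coordinatewise form is what makes distance conditions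
  definable.\<close>

lemma sup_dist_less_iff: "sup_dist x y < r \<longleftrightarrow> 0 < r \<and> (\<forall>i<length x. \<bar>x ! i - y ! i\<bar> < r)"
  unfolding sup_dist_def using finite_sup_dist[of x y] by (subst Max_less_iff) auto

lemma sup_dist_le_iff: "sup_dist x y \<le> r \<longleftrightarrow> 0 \<le> r \<and> (\<forall>i<length x. \<bar>x ! i - y ! i\<bar> \<le> r)"
  unfolding sup_dist_def using finite_sup_dist[of x y] by (subst Max_le_iff) auto

lemma sup_dist_nonneg: "0 \<le> sup_dist x y"
  using sup_dist_le_iff[of x y "sup_dist x y"] by simp

lemma sup_dist_commute:
  assumes "length x = length y" shows "sup_dist x y = sup_dist y x"
proof -
  have "sup_dist x y \<le> r \<longleftrightarrow> sup_dist y x \<le> r" for r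
    using assms by (simp add: sup_dist_le_iff abs_minus_commute)
  then show ?thesis by (metis order_antisym order_refl)
qed

lemma sup_dist_triangle:
  assumes "length x = length y" shows "sup_dist x z \<le> sup_dist x y + sup_dist y z"
  unfolding sup_dist_le_iff
proof (intro conjI allI impI)
  show "0 \<le> sup_dist x y + sup_dist y z"
    by (simp add: sup_dist_nonneg)
  fix i assume i: "i < length x"
  have "\<bar>x ! i - z ! i\<bar> \<le> \<bar>x ! i - y ! i\<bar> + \<bar>y ! i - z ! i\<bar>"
    using abs_triangle_ineq[of "x ! i - y ! i" "y ! i - z ! i"] by simp
  also have "\<dots> \<le> sup_dist x y + sup_dist y z"
    using i assms sup_dist_le_iff[of x y "sup_dist x y"] sup_dist_le_iff[of y z "sup_dist y z"]
    by (intro add_mono) auto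
  finally show "\<bar>x ! i - z ! i\<bar> \<le> sup_dist x y + sup_dist y z" .
qed

lemma sup_dist_eq_0_iff:
  assumes "length x = length y" shows "sup_dist x y = 0 \<longleftrightarrow> x = y"
proof -
  have "sup_dist x y = 0 \<longleftrightarrow> sup_dist x y \<le> 0"
    using sup_dist_nonneg[of x y] by auto
  also have "\<dots> \<longleftrightarrow> x = y"
    using assms by (auto simp: sup_dist_le_iff intro: nth_equalityI)
  finally show ?thesis .
qed

text \<open>Turns a supremum into an equivalence that can be used for rewriting, in the form
  delivered by \<open>definable_lub\<close>.\<close>

lemma isLub_UNIV_iff: "isLub UNIV S u \<longleftrightarrow> (\<forall>v. (\<forall>x\<in>S. x \<le> v) \<longleftrightarrow> u \<le> (v :: 'a::linorder))"
proof (rule iffI, rule allI)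
  fix v assume "isLub UNIV S u"
  then have *: "\<And>x. x \<in> S \<Longrightarrow> x \<le> u" "\<And>v. (\<And>x. x \<in> S \<Longrightarrow> x \<le> v) \<Longrightarrow> u \<le> v"
    by (auto simp: isLub_def leastP_def isUb_def setle_def setge_def)
  show "(\<forall>x\<in>S. x \<le> v) \<longleftrightarrow> u \<le> v"
  proof
    show "\<forall>x\<in>S. x \<le> v" if u: "u \<le> v"
      by (intro ballI order_trans[OF _ u] *(1))
  qed (intro *(2), blast)
next
  assume *: "\<forall>v. (\<forall>x\<in>S. x \<le> v) \<longleftrightarrow> u \<le> v"
  then have "\<forall>x\<in>S. x \<le> u"
    using *[THEN spec, of u] by simp
  then show "isLub UNIV S u"
    using * by (simp add: isLub_def leastP_def isUb_def setle_def setge_def)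
qed

lemma isGlb_UNIV_iff: "isGlb UNIV S u \<longleftrightarrow> (\<forall>v. (\<forall>x\<in>S. v \<le> x) \<longleftrightarrow> (v :: 'a::linorder) \<le> u)"
proof (rule iffI, rule allI)
  fix v assume "isGlb UNIV S u"
  then have *: "\<And>x. x \<in> S \<Longrightarrow> u \<le> x" "\<And>v. (\<And>x. x \<in> S \<Longrightarrow> v \<le> x) \<Longrightarrow> v \<le> u"
    by (auto simp: isGlb_def greatestP_def isLb_def setle_def setge_def)
  show "(\<forall>x\<in>S. v \<le> x) \<longleftrightarrow> v \<le> u"
  proof
    show "\<forall>x\<in>S. v \<le> x" if u: "v \<le> u"
      by (intro ballI order_trans[OF u] *(1))
  qed (intro *(2), blast)
next
  assume *: "\<forall>v. (\<forall>x\<in>S. v \<le> x) \<longleftrightarrow> v \<le> u"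
  then have "\<forall>x\<in>S. u \<le> x"
    using *[THEN spec, of u] by simp
  then show "isGlb UNIV S u"
    using * by (simp add: isGlb_def greatestP_def isLb_def setle_def setge_def)
qed

text \<open>One half of a bound on the Hausdorff distance: for every x in A the infimum of the
  distances to B is at most r. The slack \<epsilon> is there because that infimum need not be
  attained, and the formulation does not presuppose that it exists.\<close>

definition hausdorff_semidist_le :: "'m::linordered_field list set \<Rightarrow> 'm list set \<Rightarrow> 'm \<Rightarrow> bool" where
  "hausdorff_semidist_le A B r \<longleftrightarrow> (\<forall>x\<in>A. \<forall>\<epsilon>>0. \<exists>y\<in>B. sup_dist x y < r + \<epsilon>)"

lemma hausdorff_semidist_le_mono:
  assumes "hausdorff_semidist_le A B r" "r \<le> s" shows "hausdorff_semidist_le A B s"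
  unfolding hausdorff_semidist_le_def
proof (intro ballI allI impI)
  fix x and \<epsilon> :: 'a assume "x \<in> A" "0 < \<epsilon>"
  then obtain y where "y \<in> B" "sup_dist x y < r + \<epsilon>"
    using assms(1) unfolding hausdorff_semidist_le_def by blast
  moreover have "r + \<epsilon> \<le> s + \<epsilon>"
    using assms(2) by simp
  ultimately show "\<exists>y\<in>B. sup_dist x y < s + \<epsilon>"
    by (blast intro: less_le_trans)
qed

lemma glb_le_iff:
  fixes d :: "'b \<Rightarrow> 'a::linordered_field"
  assumes "isGlb UNIV (d ` B) g"
  shows "g \<le> r \<longleftrightarrow> (\<forall>\<epsilon>>0. \<exists>y\<in>B. d y < r + \<epsilon>)"
proof
  assume "g \<le> r"
  show "\<forall>\<epsilon>>0. \<exists>y\<in>B. d y < r + \<epsilon>"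
  proof (intro allI impI)
    fix \<epsilon> :: 'a assume "0 < \<epsilon>"
    with \<open>g \<le> r\<close> have "\<not> r + \<epsilon> \<le> g" by simp
    then have "\<not> (\<forall>y\<in>B. r + \<epsilon> \<le> d y)"
      using assms[unfolded isGlb_UNIV_iff, THEN spec, of "r + \<epsilon>"] by simp
    then show "\<exists>y\<in>B. d y < r + \<epsilon>"
      by (auto simp: not_le)
  qed
next
  assume r: "\<forall>\<epsilon>>0. \<exists>y\<in>B. d y < r + \<epsilon>"
  have g: "g \<le> d y" if "y \<in> B" for y
    using assms[unfolded isGlb_UNIV_iff, THEN spec, of g] that by simp
  show "g \<le> r"
  proof (rule field_le_epsilon)
    fix \<epsilon> :: 'a assume "0 < \<epsilon>"
    then obtain y where "y \<in> B" "d y < r + \<epsilon>"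
      using r by blast
    then show "g \<le> r + \<epsilon>"
      using g[of y] by linarith
  qed
qed

lemma lub_glb_le_iff:
  assumes "\<And>x. x \<in> A \<Longrightarrow> isGlb UNIV (sup_dist x ` B) (\<delta> x)" "isLub UNIV (\<delta> ` A) u"
  shows "u \<le> s \<longleftrightarrow> hausdorff_semidist_le A B s"
proof -
  have "u \<le> s \<longleftrightarrow> (\<forall>x\<in>A. \<delta> x \<le> s)"
    using assms(2)[unfolded isLub_UNIV_iff, THEN spec, of s] by simp
  also have "\<dots> \<longleftrightarrow> hausdorff_semidist_le A B s"
    unfolding hausdorff_semidist_le_def by (intro ball_cong refl glb_le_iff[OF assms(1)])
  finally show ?thesis .
qed

text \<open>An element of a linear order is determined by the elements above it, so this replaces
  the nested suprema and infima in all later arguments about a given distance.\<close>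

lemma is_hausdorff_dist_le_iff:
  assumes "is_hausdorff_dist A B r"
  shows "r \<le> s \<longleftrightarrow> hausdorff_semidist_le A B s \<and> hausdorff_semidist_le B A s"
proof -
  obtain \<delta> \<delta>' u v where *: "\<forall>x\<in>A. isGlb UNIV (sup_dist x ` B) (\<delta> x)" "isLub UNIV (\<delta> ` A) u"
    "\<forall>y\<in>B. isGlb UNIV (sup_dist y ` A) (\<delta>' y)" "isLub UNIV (\<delta>' ` B) v" "r = max u v"
    using assms unfolding is_hausdorff_dist_def by blast
  have "u \<le> s \<longleftrightarrow> hausdorff_semidist_le A B s"
    by (rule lub_glb_le_iff[OF _ *(2)]) (simp add: *(1))
  moreover have "v \<le> s \<longleftrightarrow> hausdorff_semidist_le B A s"
    by (rule lub_glb_le_iff[OF _ *(4)]) (simp add: *(3))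
  ultimately show ?thesis by (simp add: *(5))
qed

lemma is_hausdorff_dist_unique:
  assumes "is_hausdorff_dist A B r" "is_hausdorff_dist A B s" shows "r = s"
  using is_hausdorff_dist_le_iff[OF assms(1), of r] is_hausdorff_dist_le_iff[OF assms(1), of s]
    is_hausdorff_dist_le_iff[OF assms(2), of r] is_hausdorff_dist_le_iff[OF assms(2), of s] by simp

lemma hausdorff_semidist_least_is_lub:
  assumes "\<And>x. x \<in> A \<Longrightarrow> isGlb UNIV (sup_dist x ` B) (\<delta> x)"
    and "\<And>s. hausdorff_semidist_le A B s \<longleftrightarrow> u \<le> s"
  shows "isLub UNIV (\<delta> ` A) u"
  unfolding isLub_UNIV_iff assms(2)[symmetric] hausdorff_semidist_le_def ball_simps
  by (intro allI ball_cong refl glb_le_iff[OF assms(1)])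

lemma is_hausdorff_distI:
  assumes "\<And>x. x \<in> A \<Longrightarrow> isGlb UNIV (sup_dist x ` B) (\<delta> x)"
    and "\<And>s. hausdorff_semidist_le A B s \<longleftrightarrow> u \<le> s"
    and "\<And>y. y \<in> B \<Longrightarrow> isGlb UNIV (sup_dist y ` A) (\<delta>' y)"
    and "\<And>s. hausdorff_semidist_le B A s \<longleftrightarrow> v \<le> s"
  shows "is_hausdorff_dist A B (max u v)"
  unfolding is_hausdorff_dist_def
  using hausdorff_semidist_least_is_lub[OF assms(1,2)] hausdorff_semidist_least_is_lub[OF assms(3,4)]
    assms(1,3) by (intro exI[of _ \<delta>] exI[of _ \<delta>'] exI[of _ u] exI[of _ v]) simp

lemma hausdorff_semidist_le_trans:
  assumes "hausdorff_semidist_le A B r" "hausdorff_semidist_le B C s"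
    and len: "\<And>x y. x \<in> A \<Longrightarrow> y \<in> B \<Longrightarrow> length x = length y"
  shows "hausdorff_semidist_le A C (r + s)"
  unfolding hausdorff_semidist_le_def
proof (intro ballI allI impI)
  fix x and \<epsilon> :: 'a assume x: "x \<in> A" and \<epsilon>: "0 < \<epsilon>"
  then have \<epsilon>2: "0 < \<epsilon> / 2" by simp
  obtain y where y: "y \<in> B" "sup_dist x y < r + \<epsilon> / 2"
    using assms(1) x \<epsilon>2 unfolding hausdorff_semidist_le_def by blast
  obtain z where z: "z \<in> C" "sup_dist y z < s + \<epsilon> / 2"
    using assms(2) y(1) \<epsilon>2 unfolding hausdorff_semidist_le_def by blast
  have "sup_dist x z \<le> sup_dist x y + sup_dist y z"
    by (rule sup_dist_triangle[OF len[OF x y(1)]])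
  also have "\<dots> < (r + \<epsilon> / 2) + (s + \<epsilon> / 2)"
    using y(2) z(2) by (rule add_strict_mono)
  also have "\<dots> = r + s + \<epsilon>"
    by (simp add: field_simps)
  finally show "\<exists>z\<in>C. sup_dist x z < r + s + \<epsilon>"
    using z(1) by blast
qed

lemma hausdorff_semidist_le_nonneg:
  assumes "hausdorff_semidist_le A B r" "A \<noteq> {}" shows "0 \<le> r"
proof -
  obtain x where x: "x \<in> A" using assms(2) by blast
  show ?thesis
  proof (rule field_le_epsilon)
    fix \<epsilon> :: 'a assume "0 < \<epsilon>"
    then obtain y where "sup_dist x y < r + \<epsilon>"
      using assms(1) x unfolding hausdorff_semidist_le_def by blast
    then show "0 \<le> r + \<epsilon>"
      using sup_dist_nonneg[of x y] by linarith
  qed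
qed


section \<open>Definable curves\<close>

lemma sup_ball_Int_trace:
  assumes "\<And>s. length (\<gamma> s) = length a"
  shows "sup_ball a t \<inter> trace \<gamma> = \<gamma> ` {p. 0 < p \<and> p < 1 \<and> sup_dist a (\<gamma> p) < t}"
  using assms by (auto simp: sup_ball_def trace_def)

text \<open>Outside (0,1) a curve is unconstrained and may even take lists of the wrong length.
  Filling in the constant a yields a total function with definable coordinates and the same
  trace.\<close>

definition extend_curve :: "'m::linordered_field list \<Rightarrow> ('m \<Rightarrow> 'm list) \<Rightarrow> 'm \<Rightarrow> 'm list" where
  "extend_curve a \<gamma> s = (if 0 < s \<and> s < 1 then \<gamma> s else a)"

lemma trace_extend_curve: "trace (extend_curve a \<gamma>) = trace \<gamma>"
  by (auto simp: trace_def extend_curve_def)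

context ordered_field_expansion
begin

text \<open>Coordinate functions rather than the graph, because they can be substituted into the
  coordinatewise description of \<open>sup_dist\<close>.\<close>

definition def_curve :: "nat \<Rightarrow> ('m \<Rightarrow> 'm list) \<Rightarrow> bool" where
  "def_curve k \<gamma> \<longleftrightarrow> (\<forall>s. length (\<gamma> s) = k) \<and> (\<forall>i<k. def_fun (\<lambda>v. \<gamma> (v 0) ! i))"

lemma def_curve_length: "def_curve k \<gamma> \<Longrightarrow> length (\<gamma> s) = k"
  by (simp add: def_curve_def)

lemma def_curve_const: "length x = k \<Longrightarrow> def_curve k (\<lambda>_. x)"
  by (simp add: def_curve_def def_fun_const)

lemma def_curve_extend_curve:
  assumes \<gamma>: "\<gamma> \<in> curves_at L M k a" and a: "length a = k"
  shows "def_curve k (extend_curve a \<gamma>)"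
  unfolding def_curve_def
proof (intro conjI allI impI)
  have len: "length (\<gamma> s) = k" if "0 < s" "s < 1" for s
    using \<gamma> that by (simp add: curves_at_def)
  then show "length (extend_curve a \<gamma> s) = k" for s
    using a by (simp add: extend_curve_def)
  fix i assume i: "i < k"
  \<comment> \<open>Q is the definable graph of \<gamma>, with the parameter in coordinate 0 and the
    k entries of the value behind it.\<close>
  define Q where "Q v \<longleftrightarrow> 0 < v 0 \<and> v 0 < 1 \<and> \<gamma> (v 0) = map (\<lambda>i. v (Suc i)) [0..<k]" for v
  have "def_pred (\<lambda>v. map v [0..<Suc k] \<in> {t # \<gamma> t | t. t \<in> {0<..<1}})"
    using \<gamma> by (intro definable_def_pred) (simp add: curves_at_def)
  moreover have "map v [0..<Suc k] = v 0 # map (\<lambda>i. v (Suc i)) [0..<k]" for v :: "nat \<Rightarrow> 'm"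
    by (simp add: map_upt_Suc del: upt_Suc)
  then have "map v [0..<Suc k] \<in> {t # \<gamma> t | t. t \<in> {0<..<1}} \<longleftrightarrow> Q v" for v
    by (auto simp: Q_def simp del: upt_Suc)
  ultimately have "def_pred Q"
    by simp
  \<comment> \<open>To project to entry i, the k entries of the value move to coordinates 0 to k -
    1, where \<open>def_pred_ex_list\<close> quantifies over them. The claimed entry sits at
    coordinate k and the parameter of \<gamma> at k + 1; after the quantification these are
    coordinates 0 and 1, as \<open>def_fun\<close> requires.\<close>
  then have "def_pred (\<lambda>w. Q (\<lambda>j. w (case_nat (Suc k) id j)))"
    by (rule def_pred_rename)
  then have "def_pred (\<lambda>w. Q (\<lambda>j. w (case_nat (Suc k) id j)) \<and> w k = w i)"
    by (intro def_intros)
  then have P: "def_pred (\<lambda>v. \<exists>xs. length xs = k \<and>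
      Q (\<lambda>j. if case_nat (Suc k) id j < k then xs ! (case_nat (Suc k) id j)
          else v (case_nat (Suc k) id j - k)) \<and>
      (if k < k then xs ! k else v (k - k)) = (if i < k then xs ! i else v (i - k)))"
    by (rule def_pred_ex_list)
  have Q: "Q (\<lambda>j. if case_nat (Suc k) id j < k then xs ! (case_nat (Suc k) id j)
          else v (case_nat (Suc k) id j - k)) \<longleftrightarrow> 0 < v 1 \<and> v 1 < 1 \<and> \<gamma> (v 1) = xs"
    if "length xs = k" for xs v
  proof -
    have "map (\<lambda>j. if j < k then xs ! j else v (j - k)) [0..<k] = xs"
      using that by (intro nth_equalityI) auto
    then show ?thesis by (simp add: Q_def cong: if_cong)
  qed
  have eq: "v 0 = extend_curve a \<gamma> (v (Suc 0)) ! i \<longleftrightarrow>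
      (\<exists>xs. length xs = k \<and>
        Q (\<lambda>j. if case_nat (Suc k) id j < k then xs ! (case_nat (Suc k) id j)
            else v (case_nat (Suc k) id j - k)) \<and>
        (if k < k then xs ! k else v (k - k)) = (if i < k then xs ! i else v (i - k))) \<or>
      \<not> (0 < v (Suc 0) \<and> v (Suc 0) < 1) \<and> v 0 = a ! i" for v
    using i Q[of _ v] len[of "v 1"] by (auto simp: extend_curve_def cong: conj_cong)
  show "def_fun (\<lambda>v. extend_curve a \<gamma> (v 0) ! i)"
    unfolding def_fun_def eq by (intro def_pred_disj P) (intro def_intros)
qed

lemma def_pred_sup_dist_less:
  assumes "def_curve k \<gamma>" "def_curve k \<sigma>" "def_fun F" "def_fun G" "def_fun H"
  shows "def_pred (\<lambda>v. sup_dist (\<gamma> (F v)) (\<sigma> (G v)) < H v)"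
proof -
  have "def_fun (\<lambda>v. \<gamma> (F v) ! i)" "def_fun (\<lambda>v. \<sigma> (G v) ! i)" if "i < k" for i
    using that assms unfolding def_curve_def
    by (auto intro: def_fun_comp1[of "\<lambda>s. \<gamma> s ! i"] def_fun_comp1[of "\<lambda>s. \<sigma> s ! i"])
  then show ?thesis
    unfolding sup_dist_less_iff def_curve_length[OF assms(1)]
    by (intro def_pred_conj def_pred_ball def_pred_less def_fun_abs def_fun_diff def_fun_const assms)
qed

lemma def_pred_sup_dist_less_point:
  assumes "length x = k" "def_curve k \<gamma>" "def_fun G" "def_fun H"
  shows "def_pred (\<lambda>v. sup_dist x (\<gamma> (G v)) < H v)"
  by (rule def_pred_sup_dist_less[OF def_curve_const[OF assms(1)] assms(2) def_fun_const assms(3,4)])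

text \<open>Replacing points of the traces by parameters p and q leaves only quantifiers over
  \<open>M\<close>. Radius and bound are both allowed to vary: a fixed radius serves the existence
  of the distance, a varying one its definability as a function of the radius.\<close>

lemma def_pred_hausdorff_semidist_le:
  assumes "def_curve k \<gamma>" "def_curve k \<sigma>" "length a = k" "def_fun F" "def_fun G"
  shows "def_pred (\<lambda>v. hausdorff_semidist_le (sup_ball a (F v) \<inter> trace \<gamma>)
    (sup_ball a (F v) \<inter> trace \<sigma>) (G v))"
proof (rule def_pred_comp2[OF _ assms(4,5)])
  have eq: "hausdorff_semidist_le (sup_ball a t \<inter> trace \<gamma>) (sup_ball a t \<inter> trace \<sigma>) r \<longleftrightarrow>
    (\<forall>p. 0 < p \<and> p < 1 \<and> sup_dist a (\<gamma> p) < t \<longrightarrow>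
      (\<forall>\<epsilon>. 0 < \<epsilon> \<longrightarrow>
        (\<exists>q. (0 < q \<and> q < 1 \<and> sup_dist a (\<sigma> q) < t) \<and> sup_dist (\<gamma> p) (\<sigma> q) < r + \<epsilon>)))" for t r
  proof -
    have ball_trace: "sup_ball a t \<inter> trace \<gamma> = \<gamma> ` {p. 0 < p \<and> p < 1 \<and> sup_dist a (\<gamma> p) < t}"
      "sup_ball a t \<inter> trace \<sigma> = \<sigma> ` {p. 0 < p \<and> p < 1 \<and> sup_dist a (\<sigma> p) < t}"
      using assms(1-3) by (simp_all add: sup_ball_Int_trace def_curve_length)
    show ?thesis
      unfolding hausdorff_semidist_le_def ball_trace ball_simps bex_simps
      unfolding Ball_def Bex_def mem_Collect_eq
      by (rule refl)
  qed
  show "def_pred (\<lambda>v. hausdorff_semidist_le (sup_ball a (v 0) \<inter> trace \<gamma>)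
      (sup_ball a (v 0) \<inter> trace \<sigma>) (v 1))"
    unfolding eq
    by (intro def_intros def_pred_sup_dist_less[OF assms(1,2)]
      def_pred_sup_dist_less_point[OF assms(3,1)] def_pred_sup_dist_less_point[OF assms(3,2)])
qed

end


section \<open>Existence of local Hausdorff distances\<close>

context o_minimal_expansion
begin

lemma glb_sup_dist_ex:
  assumes "def_curve k \<sigma>" "length a = k" "length x = k" "sup_ball a t \<inter> trace \<sigma> \<noteq> {}"
  shows "\<exists>g. isGlb UNIV (sup_dist x ` (sup_ball a t \<inter> trace \<sigma>)) g"
proof -
  \<comment> \<open>The elements above some distance have the same lower bounds as the distances
    themselves, by density, and are described by strict inequalities, whose definability is already
    known.\<close>
  define P where "P r \<longleftrightarrow> (\<exists>q. (0 < q \<and> q < 1 \<and> sup_dist a (\<sigma> q) < t) \<and> sup_dist x (\<sigma> q) < r)" for r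
  have ball_trace: "sup_ball a t \<inter> trace \<sigma> = \<sigma> ` {p. 0 < p \<and> p < 1 \<and> sup_dist a (\<sigma> p) < t}"
    using assms(1,2) by (simp add: sup_ball_Int_trace def_curve_length)
  obtain q where q: "0 < q" "q < 1" "sup_dist a (\<sigma> q) < t"
    using assms(4) unfolding ball_trace by blast
  have d: "def_pred (\<lambda>v. P (v 0))"
    unfolding P_def
    by (intro def_intros def_pred_sup_dist_less_point[OF assms(2,1)]
        def_pred_sup_dist_less_point[OF assms(3,1)])
  have n: "P (sup_dist x (\<sigma> q) + 1)"
    unfolding P_def using q by (intro exI[of _ q]) simp
  have b: "0 \<le> r" if "P r" for r
    using that unfolding P_def by (meson less_imp_le order_le_less_trans sup_dist_nonneg)
  obtain g where g: "\<And>v. (\<forall>r. P r \<longrightarrow> v \<le> r) \<longleftrightarrow> v \<le> g"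
    by (rule definable_glb[of P, OF d n b], assumption, rule that)
  have "(\<forall>r. P r \<longrightarrow> v \<le> r) \<longleftrightarrow> (\<forall>z \<in> sup_dist x ` (sup_ball a t \<inter> trace \<sigma>). v \<le> z)" for v
  proof
    assume v: "\<forall>r. P r \<longrightarrow> v \<le> r"
    show "\<forall>z \<in> sup_dist x ` (sup_ball a t \<inter> trace \<sigma>). v \<le> z"
    proof
      fix z assume "z \<in> sup_dist x ` (sup_ball a t \<inter> trace \<sigma>)"
      then obtain q where "0 < q \<and> q < 1 \<and> sup_dist a (\<sigma> q) < t" "z = sup_dist x (\<sigma> q)"
        unfolding ball_trace by blast
      then have "v \<le> r" if "z < r" for r
        using v that unfolding P_def by blast
      then show "v \<le> z" by (rule dense_ge)
    qed
  next
    assume v: "\<forall>z \<in> sup_dist x ` (sup_ball a t \<inter> trace \<sigma>). v \<le> z"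
    show "\<forall>r. P r \<longrightarrow> v \<le> r"
    proof (intro allI impI)
      fix r assume "P r"
      then obtain q where "0 < q \<and> q < 1 \<and> sup_dist a (\<sigma> q) < t" "sup_dist x (\<sigma> q) < r"
        unfolding P_def by blast
      then show "v \<le> r"
        using v unfolding ball_trace by (blast intro: order_trans less_imp_le)
    qed
  qed
  then have "isGlb UNIV (sup_dist x ` (sup_ball a t \<inter> trace \<sigma>)) g"
    unfolding isGlb_UNIV_iff using g by (intro allI) (rule trans[OF sym])
  then show ?thesis ..
qed

lemma hausdorff_semidist_least_ex:
  fixes a :: "'m list"
  assumes "def_curve k \<gamma>" "def_curve k \<sigma>" "length a = k"
    and "sup_ball a t \<inter> trace \<gamma> \<noteq> {}" "sup_ball a t \<inter> trace \<sigma> \<noteq> {}"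
  shows "\<exists>u. \<forall>s. hausdorff_semidist_le (sup_ball a t \<inter> trace \<gamma>) (sup_ball a t \<inter> trace \<sigma>) s \<longleftrightarrow> u \<le> s"
proof -
  let ?A = "sup_ball a t \<inter> trace \<gamma>" and ?B = "sup_ball a t \<inter> trace \<sigma>"
  have d: "def_pred (\<lambda>v. hausdorff_semidist_le ?A ?B (v 0))"
    by (intro def_pred_hausdorff_semidist_le[OF assms(1-3), of "\<lambda>_. t"] def_intros)
  \<comment> \<open>Any two points of the ball are joined through its center a, so twice the radius
    is always a valid bound.\<close>
  have n: "hausdorff_semidist_le ?A ?B (t + t)"
    unfolding hausdorff_semidist_le_def
  proof (intro ballI allI impI)
    fix x and \<epsilon> :: 'm assume x: "x \<in> ?A" and \<epsilon>: "0 < \<epsilon>"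
    obtain y where y: "y \<in> ?B" using assms(5) by blast
    have "sup_dist x y \<le> sup_dist x a + sup_dist a y"
      using x by (intro sup_dist_triangle) (simp add: sup_ball_def)
    also have "\<dots> = sup_dist a x + sup_dist a y"
      using x by (subst sup_dist_commute) (simp_all add: sup_ball_def)
    also have "\<dots> < t + t"
      using x y by (intro add_strict_mono) (simp_all add: sup_ball_def)
    finally have "sup_dist x y < t + t + \<epsilon>"
      using \<epsilon> by simp
    then show "\<exists>y\<in>?B. sup_dist x y < t + t + \<epsilon>"
      using y by blast
  qed
  have b: "0 \<le> r" if "hausdorff_semidist_le ?A ?B r" for r
    using hausdorff_semidist_le_nonneg[OF that assms(4)] .
  obtain u where u: "\<And>v. (\<forall>r. hausdorff_semidist_le ?A ?B r \<longrightarrow> v \<le> r) \<longleftrightarrow> v \<le> u"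
    by (rule definable_glb[of "hausdorff_semidist_le ?A ?B", OF d n b], assumption, rule that)
  \<comment> \<open>The infimum u of the valid bounds is itself valid: half of the slack pays for a
    valid bound near u, the other half for the approximating point.\<close>
  have le_u: "hausdorff_semidist_le ?A ?B u"
    unfolding hausdorff_semidist_le_def
  proof (intro ballI allI impI)
    fix x and \<epsilon> :: 'm assume x: "x \<in> ?A" and \<epsilon>: "0 < \<epsilon>"
    have "\<not> u + \<epsilon> / 2 \<le> u"
      using \<epsilon> by simp
    then obtain r where r: "hausdorff_semidist_le ?A ?B r" "r < u + \<epsilon> / 2"
      unfolding u[symmetric] by (auto simp: not_le)
    then obtain y where "y \<in> ?B" "sup_dist x y < r + \<epsilon> / 2"
      using x \<epsilon> unfolding hausdorff_semidist_le_def by (meson half_gt_zero)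
    moreover have "r + \<epsilon> / 2 < u + \<epsilon>"
      using r(2) by (simp add: field_simps)
    ultimately show "\<exists>y\<in>?B. sup_dist x y < u + \<epsilon>"
      by (blast intro: less_trans)
  qed
  have "u \<le> s" if "hausdorff_semidist_le ?A ?B s" for s
    using u[of u] that by blast
  then show ?thesis
    using hausdorff_semidist_le_mono[OF le_u] by (intro exI[of _ u] allI iffI)
qed

lemma is_hausdorff_dist_ex:
  assumes "def_curve k \<gamma>" "def_curve k \<sigma>" "length a = k"
    and "sup_ball a t \<inter> trace \<gamma> \<noteq> {}" "sup_ball a t \<inter> trace \<sigma> \<noteq> {}"
  shows "\<exists>r. is_hausdorff_dist (sup_ball a t \<inter> trace \<gamma>) (sup_ball a t \<inter> trace \<sigma>) r"
proof -
  let ?A = "sup_ball a t \<inter> trace \<gamma>" and ?B = "sup_ball a t \<inter> trace \<sigma>"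
  have len: "length x = k" if "x \<in> ?A \<union> ?B" for x
    using that assms(3) by (auto simp: sup_ball_def)
  obtain u where u: "\<forall>s. hausdorff_semidist_le ?A ?B s \<longleftrightarrow> u \<le> s"
    using hausdorff_semidist_least_ex[OF assms] ..
  obtain v where v: "\<forall>s. hausdorff_semidist_le ?B ?A s \<longleftrightarrow> v \<le> s"
    using hausdorff_semidist_least_ex[OF assms(2,1,3,5,4)] ..
  have "is_hausdorff_dist ?A ?B (max u v)"
  proof (rule is_hausdorff_distI)
    show "isGlb UNIV (sup_dist x ` ?B) (SOME g. isGlb UNIV (sup_dist x ` ?B) g)" if "x \<in> ?A" for x
      by (rule someI_ex[OF glb_sup_dist_ex[OF assms(2,3) len assms(5)]]) (rule UnI1[OF that])
    show "isGlb UNIV (sup_dist x ` ?A) (SOME g. isGlb UNIV (sup_dist x ` ?A) g)" if "x \<in> ?B" for x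
      by (rule someI_ex[OF glb_sup_dist_ex[OF assms(1,3) len assms(4)]]) (rule UnI2[OF that])
    show "hausdorff_semidist_le ?A ?B s \<longleftrightarrow> u \<le> s" "hausdorff_semidist_le ?B ?A s \<longleftrightarrow> v \<le> s" for s
      by (rule u[THEN spec] v[THEN spec])+
  qed
  then show ?thesis ..
qed


section \<open>Limit points of a definable curve\<close>

definition limit_at_1 :: "('m \<Rightarrow> 'm list) \<Rightarrow> 'm list \<Rightarrow> bool" where
  "limit_at_1 \<gamma> x \<longleftrightarrow> (\<forall>\<eta>>0. \<exists>c<1. \<forall>s. c < s \<and> s < 1 \<longrightarrow> sup_dist x (\<gamma> s) < \<eta>)"

text \<open>Failure of convergence alone says that the curve is far from x at some parameters
  arbitrarily close to 1. The dichotomy to the left of 1 upgrades this to a whole interval.\<close>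

lemma not_limit_at_1:
  assumes "def_curve k \<gamma>" "length x = k" "\<not> limit_at_1 \<gamma> x"
  obtains \<eta> c where "0 < \<eta>" "c < 1" "\<And>s. c < s \<Longrightarrow> s < 1 \<Longrightarrow> \<not> sup_dist x (\<gamma> s) < \<eta>"
proof -
  obtain \<eta> where \<eta>: "0 < \<eta>" "\<not> (\<exists>c<1. \<forall>s. c < s \<and> s < 1 \<longrightarrow> sup_dist x (\<gamma> s) < \<eta>)"
    using assms(3) unfolding limit_at_1_def by blast
  have d: "def_pred (\<lambda>v. sup_dist x (\<gamma> (v 0)) < \<eta>)"
    by (intro def_pred_sup_dist_less_point[OF assms(2,1)] def_intros)
  obtain c where "c < 1" "(\<forall>s. c < s \<and> s < 1 \<longrightarrow> sup_dist x (\<gamma> s) < \<eta>) \<or>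
      (\<forall>s. c < s \<and> s < 1 \<longrightarrow> \<not> sup_dist x (\<gamma> s) < \<eta>)"
    by (rule definable_left_germ[of "\<lambda>s. sup_dist x (\<gamma> s) < \<eta>", OF d, of 1], rule that)
  with \<eta>(2) have "\<And>s. c < s \<Longrightarrow> s < 1 \<Longrightarrow> \<not> sup_dist x (\<gamma> s) < \<eta>"
    by blast
  with \<eta>(1) \<open>c < 1\<close> show thesis by (rule that)
qed

lemma limit_at_1_unique:
  assumes "limit_at_1 \<gamma> x" "limit_at_1 \<gamma> y" "\<And>s. length (\<gamma> s) = k" "length x = k" "length y = k"
  shows "x = y"
proof (rule ccontr)
  assume "x \<noteq> y"
  then have "sup_dist x y \<noteq> 0"
    using assms(4,5) by (simp add: sup_dist_eq_0_iff)
  then have pos: "0 < sup_dist x y / 2"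
    using sup_dist_nonneg[of x y] by simp
  obtain c where c: "c < 1" "\<forall>s. c < s \<and> s < 1 \<longrightarrow> sup_dist x (\<gamma> s) < sup_dist x y / 2"
    using assms(1) pos unfolding limit_at_1_def by blast
  obtain d where d: "d < 1" "\<forall>s. d < s \<and> s < 1 \<longrightarrow> sup_dist y (\<gamma> s) < sup_dist x y / 2"
    using assms(2) pos unfolding limit_at_1_def by blast
  have "max c d < 1" using c(1) d(1) by simp
  then obtain s where s: "max c d < s" "s < 1"
    using dense by blast
  have "sup_dist x y \<le> sup_dist x (\<gamma> s) + sup_dist (\<gamma> s) y"
    using assms(3,4) by (intro sup_dist_triangle) simp
  also have "sup_dist (\<gamma> s) y = sup_dist y (\<gamma> s)"
    using assms(3,5) by (intro sup_dist_commute) simp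
  also have "sup_dist x (\<gamma> s) + sup_dist y (\<gamma> s) < sup_dist x y / 2 + sup_dist x y / 2"
    using c(2) d(2) s by (intro add_strict_mono) simp_all
  finally show False by simp
qed

text \<open>The supremum \<open>u\<close> of the parameters up to which \<open>\<gamma>\<close> stays away from \<open>x\<close> has to be \<open>1\<close>,
  and even at \<open>1\<close> the curve stays away from \<open>x\<close>.\<close>

lemma adherent_point_in_trace:
  assumes \<gamma>: "def_curve k \<gamma>" and a: "length a = k" and x: "length x = k" "x \<noteq> a"
    and cont: "\<And>t \<epsilon>. 0 < t \<Longrightarrow> t < 1 \<Longrightarrow> 0 < \<epsilon> \<Longrightarrow>
      \<exists>\<delta>>0. \<forall>s. 0 < s \<and> s < 1 \<and> \<bar>s - t\<bar> < \<delta> \<longrightarrow> sup_dist (\<gamma> t) (\<gamma> s) < \<epsilon>"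
    and lim: "\<And>\<epsilon>. 0 < \<epsilon> \<Longrightarrow> near0 (\<lambda>t. sup_dist a (\<gamma> t) < \<epsilon>)"
    and nlim: "\<not> limit_at_1 \<gamma> x"
    and adh: "\<And>\<eta>. 0 < \<eta> \<Longrightarrow> \<exists>s. 0 < s \<and> s < 1 \<and> sup_dist x (\<gamma> s) < \<eta>"
  shows "x \<in> trace \<gamma>"
proof (rule ccontr)
  assume notin: "x \<notin> trace \<gamma>"
  have pos: "0 < sup_dist x (\<gamma> s)" if "0 < s" "s < 1" for s
  proof -
    have "x \<noteq> \<gamma> s"
      using notin that by (auto simp: trace_def)
    then show ?thesis
      using sup_dist_eq_0_iff[of x "\<gamma> s"] sup_dist_nonneg[of x "\<gamma> s"] x(1) def_curve_length[OF \<gamma>, of s]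
      by simp
  qed
  have away: "\<not> sup_dist x (\<gamma> s) < e / 2" if "e \<le> sup_dist y x" "sup_dist y (\<gamma> s) < e / 2" "length y = k"
    for e y s
  proof
    assume *: "sup_dist x (\<gamma> s) < e / 2"
    have "sup_dist y x \<le> sup_dist y (\<gamma> s) + sup_dist (\<gamma> s) x"
      using that(3) def_curve_length[OF \<gamma>] by (intro sup_dist_triangle) simp
    also have "sup_dist (\<gamma> s) x = sup_dist x (\<gamma> s)"
      using x(1) def_curve_length[OF \<gamma>] by (intro sup_dist_commute) simp
    also have "sup_dist y (\<gamma> s) + sup_dist x (\<gamma> s) < e / 2 + e / 2"
      using that(2) * by (rule add_strict_mono)
    finally show False using that(1) by simp
  qed
  \<comment> \<open>W collects the s for which \<gamma> keeps a positive distance from x on all of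
    (0,s]. The bound \<eta> may depend on s, which keeps W definable.\<close>
  define W where "W s \<longleftrightarrow> (0 < s \<and> s < 1) \<and>
      (\<exists>\<eta>. 0 < \<eta> \<and> (\<forall>s'. 0 < s' \<and> s' \<le> s \<longrightarrow> \<not> sup_dist x (\<gamma> s') < \<eta>))" for s
  have d: "def_pred (\<lambda>v. W (v 0))"
    unfolding W_def by (intro def_intros def_pred_sup_dist_less_point[OF x(1) \<gamma>])
  \<comment> \<open>Near parameter 0 the curve is closer to a than half of
    \<open>sup_dist a x\<close>, hence at least that far from x.\<close>
  obtain w0 where w0: "W w0"
  proof -
    have ax: "0 < sup_dist a x"
      using sup_dist_eq_0_iff[of a x] sup_dist_nonneg[of a x] x a by simp
    then obtain c where c: "0 < c" "\<And>t. 0 < t \<and> t < c \<Longrightarrow> sup_dist a (\<gamma> t) < sup_dist a x / 2"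
      using lim[of "sup_dist a x / 2"] unfolding near0_def by auto
    have "0 < min c 1" using c(1) by simp
    then obtain w where w: "0 < w" "w < min c 1"
      using dense by blast
    have "\<not> sup_dist x (\<gamma> s) < sup_dist a x / 2" if "0 < s \<and> s \<le> w" for s
      using c(2)[of s] that w a by (intro away[of _ a]) simp_all
    then have "W w"
      unfolding W_def using w ax by (intro conjI exI[of _ "sup_dist a x / 2"]) simp_all
    then show thesis by (rule that)
  qed
  have W1: "s \<le> 1" if "W s" for s
    using that by (simp add: W_def)
  obtain u where u: "\<And>v. (\<forall>s. W s \<longrightarrow> s \<le> v) \<longleftrightarrow> u \<le> v"
    by (rule definable_lub[of W, OF d w0 W1], assumption, rule that)
  have W_le: "s \<le> u" if "W s" for s
    using u[of u] that by simp
  have u1: "u \<le> 1"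
    using u[of 1] W1 by simp
  have u0: "0 < u"
    using W_le[OF w0] w0 by (simp add: W_def)
  \<comment> \<open>A uniform distance from x around u: for u < 1 it comes from continuity and
    \<gamma> u \<noteq> x, for u = 1 from the absence of a limit x there.\<close>
  have "\<exists>\<delta>>0. \<exists>\<eta>>0. \<forall>s. 0 < s \<and> s < 1 \<and> u - \<delta> < s \<and> s < u + \<delta> \<longrightarrow> \<not> sup_dist x (\<gamma> s) < \<eta>"
  proof (cases "u < 1")
    case True
    define e where "e = sup_dist x (\<gamma> u)"
    have e: "0 < e" "e \<le> sup_dist (\<gamma> u) x"
      using pos[OF u0 True] sup_dist_commute[of x "\<gamma> u"] x(1) def_curve_length[OF \<gamma>, of u]
      by (simp_all add: e_def)
    then obtain \<delta> where \<delta>: "0 < \<delta>"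
      "\<forall>s. 0 < s \<and> s < 1 \<and> \<bar>s - u\<bar> < \<delta> \<longrightarrow> sup_dist (\<gamma> u) (\<gamma> s) < e / 2"
      using cont[OF u0 True, of "e / 2"] by auto
    have "\<not> sup_dist x (\<gamma> s) < e / 2" if "0 < s \<and> s < 1 \<and> u - \<delta> < s \<and> s < u + \<delta>" for s
    proof (rule away[OF e(2)])
      have "\<bar>s - u\<bar> < \<delta>" using that by (simp add: abs_less_iff algebra_simps)
      then show "sup_dist (\<gamma> u) (\<gamma> s) < e / 2" using \<delta>(2) that by simp
    qed (rule def_curve_length[OF \<gamma>])
    then show ?thesis
      using \<delta>(1) e(1) by (intro exI[of _ \<delta>] conjI exI[of _ "e / 2"]) simp_all
  next
    case False
    then have "u = 1" using u1 by simp
    obtain \<eta> c where \<eta>: "0 < \<eta>" "c < 1" "\<And>s. c < s \<Longrightarrow> s < 1 \<Longrightarrow> \<not> sup_dist x (\<gamma> s) < \<eta>"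
      by (rule not_limit_at_1[OF \<gamma> x(1) nlim], rule that)
    then show ?thesis
      using \<open>u = 1\<close> by (intro exI[of _ "1 - c"] conjI exI[of _ \<eta>]) simp_all
  qed
  then obtain \<delta> \<eta> where \<delta>: "0 < \<delta>" and \<eta>: "0 < \<eta>"
    and far: "\<And>s. 0 < s \<Longrightarrow> s < 1 \<Longrightarrow> u - \<delta> < s \<Longrightarrow> s < u + \<delta> \<Longrightarrow> \<not> sup_dist x (\<gamma> s) < \<eta>"
    by blast
  have "\<not> u \<le> u - \<delta>" using \<delta> by simp
  then obtain w where w: "W w" "u - \<delta> < w"
    unfolding u[symmetric] by (auto simp: not_le)
  then obtain \<eta>' where \<eta>': "0 < \<eta>'" "\<And>s. 0 < s \<Longrightarrow> s \<le> w \<Longrightarrow> \<not> sup_dist x (\<gamma> s) < \<eta>'"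
    unfolding W_def by blast
  have far': "\<not> sup_dist x (\<gamma> s) < min \<eta> \<eta>'" if "0 < s" "s < 1" "s < u + \<delta>" for s
    using far[of s] \<eta>'(2)[of s] that w(2) by (cases "s \<le> w") simp_all
  \<comment> \<open>The bound on (0,w] and the bound around u overlap. If u < 1, together they push
    W beyond its supremum; if u = 1, they cover all of (0,1), contradicting that \<gamma> comes
    arbitrarily close to x.\<close>
  show False
  proof (cases "u < 1")
    case True
    then have "u < min 1 (u + \<delta>)" using \<delta> by simp
    then obtain s where s: "u < s" "s < min 1 (u + \<delta>)"
      using dense by blast
    have "W s"
      unfolding W_def
    proof (intro conjI exI[of _ "min \<eta> \<eta>'"] allI impI)
      show "\<not> sup_dist x (\<gamma> s') < min \<eta> \<eta>'" if "0 < s' \<and> s' \<le> s" for s'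
        using that s by (intro far') simp_all
    qed (use s u0 \<eta> \<eta>'(1) in simp_all)
    then show False using W_le[of s] s(1) by simp
  next
    case False
    then have "u = 1" using u1 by simp
    obtain s where "0 < s" "s < 1" "sup_dist x (\<gamma> s) < min \<eta> \<eta>'"
      using adh[of "min \<eta> \<eta>'"] \<eta> \<eta>'(1) by auto
    moreover have "s < u + \<delta>" using \<open>s < 1\<close> \<open>u = 1\<close> \<delta> by simp
    ultimately show False using far' by blast
  qed
qed

end


section \<open>Germs\<close>

lemma near0_pos: "(\<And>t. 0 < t \<Longrightarrow> P t) \<Longrightarrow> near0 P"
  unfolding near0_def by (intro exI[of _ 1]) simp

lemma near0_conj:
  assumes "near0 P" "near0 Q" shows "near0 (\<lambda>t. P t \<and> Q t)"
proof -
  obtain c d where "0 < c" "0 < d" "\<forall>t. 0 < t \<and> t < c \<longrightarrow> P t" "\<forall>t. 0 < t \<and> t < d \<longrightarrow> Q t"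
    using assms unfolding near0_def by blast
  then show ?thesis
    unfolding near0_def by (intro exI[of _ "min c d"]) simp
qed

lemma near0_mono: "near0 P \<Longrightarrow> (\<And>t. P t \<Longrightarrow> Q t) \<Longrightarrow> near0 Q"
  unfolding near0_def by blast

lemma germ0_cong:
  assumes "near0 (\<lambda>t. f t = g t)" shows "germ0 L M f = germ0 L M g"
proof -
  have "near0 (\<lambda>t. f t = h t) \<longleftrightarrow> near0 (\<lambda>t. g t = h t)" for h
  proof
    assume "near0 (\<lambda>t. f t = h t)"
    from near0_conj[OF assms this] show "near0 (\<lambda>t. g t = h t)"
      by (rule near0_mono) simp
  next
    assume "near0 (\<lambda>t. g t = h t)"
    from near0_conj[OF assms this] show "near0 (\<lambda>t. f t = h t)"
      by (rule near0_mono) simp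
  qed
  then show ?thesis by (simp only: germ0_def)
qed

lemma germ0_self: "definable_fun L M f \<Longrightarrow> f \<in> germ0 L M f"
  by (simp add: germ0_def near0_pos)

lemma sup_ball_mono: "s \<le> t \<Longrightarrow> sup_ball a s \<subseteq> sup_ball a t"
  by (auto simp: sup_ball_def)

lemma center_in_sup_ball: "0 < \<epsilon> \<Longrightarrow> a \<in> sup_ball a \<epsilon>"
  by (simp add: sup_ball_def sup_dist_less_iff)

lemma sup_ball_Int_eq_mono:
  assumes "sup_ball a \<epsilon> \<inter> A = sup_ball a \<epsilon> \<inter> B" "\<delta> \<le> \<epsilon>"
  shows "sup_ball a \<delta> \<inter> A = sup_ball a \<delta> \<inter> B"
  using assms sup_ball_mono[OF assms(2), of a] by blast


section \<open>Germs of curves\<close>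

lemma curve_rel_iff:
  "(\<gamma>, \<sigma>) \<in> curve_rel L M k a \<longleftrightarrow> \<gamma> \<in> curves_at L M k a \<and> \<sigma> \<in> curves_at L M k a \<and>
    (\<exists>\<epsilon>>0. sup_ball a \<epsilon> \<inter> trace \<gamma> = sup_ball a \<epsilon> \<inter> trace \<sigma>)"
  by (simp add: curve_rel_def)

lemma equiv_curve_rel: "equiv (curves_at L M k a) (curve_rel L M k a)"
proof (rule equivI)
  show "curve_rel L M k a \<subseteq> curves_at L M k a \<times> curves_at L M k a"
    by (simp add: curve_rel_def subset_iff)
  show "refl_on (curves_at L M k a) (curve_rel L M k a)"
  proof (rule refl_onI)
    fix \<gamma> assume "\<gamma> \<in> curves_at L M k a"
    then show "(\<gamma>, \<gamma>) \<in> curve_rel L M k a"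
      unfolding curve_rel_iff by (intro conjI exI[of _ 1]) simp_all
  qed
  show "sym (curve_rel L M k a)"
  proof (rule symI)
    fix \<gamma> \<sigma> assume *: "(\<gamma>, \<sigma>) \<in> curve_rel L M k a"
    then obtain \<epsilon> where "0 < \<epsilon>" "sup_ball a \<epsilon> \<inter> trace \<gamma> = sup_ball a \<epsilon> \<inter> trace \<sigma>"
      unfolding curve_rel_iff by (elim exE conjE)
    with * show "(\<sigma>, \<gamma>) \<in> curve_rel L M k a"
      unfolding curve_rel_iff by (intro conjI exI[of _ \<epsilon>]) simp_all
  qed
  show "trans (curve_rel L M k a)"
  proof (rule transI)
    fix \<gamma> \<sigma> \<tau> assume *: "(\<gamma>, \<sigma>) \<in> curve_rel L M k a" "(\<sigma>, \<tau>) \<in> curve_rel L M k a"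
    obtain \<epsilon> where \<epsilon>: "0 < \<epsilon>" "sup_ball a \<epsilon> \<inter> trace \<gamma> = sup_ball a \<epsilon> \<inter> trace \<sigma>"
      using *(1) unfolding curve_rel_iff by (elim exE conjE)
    obtain \<delta> where \<delta>: "0 < \<delta>" "sup_ball a \<delta> \<inter> trace \<sigma> = sup_ball a \<delta> \<inter> trace \<tau>"
      using *(2) unfolding curve_rel_iff by (elim exE conjE)
    have "sup_ball a (min \<epsilon> \<delta>) \<inter> trace \<gamma> = sup_ball a (min \<epsilon> \<delta>) \<inter> trace \<sigma>"
      by (rule sup_ball_Int_eq_mono[OF \<epsilon>(2)]) simp
    also have "\<dots> = sup_ball a (min \<epsilon> \<delta>) \<inter> trace \<tau>"
      by (rule sup_ball_Int_eq_mono[OF \<delta>(2)]) simp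
    finally have "sup_ball a (min \<epsilon> \<delta>) \<inter> trace \<gamma> = sup_ball a (min \<epsilon> \<delta>) \<inter> trace \<tau>" .
    moreover have "0 < min \<epsilon> \<delta>" using \<epsilon>(1) \<delta>(1) by simp
    moreover have "\<gamma> \<in> curves_at L M k a" "\<tau> \<in> curves_at L M k a"
      using * unfolding curve_rel_iff by simp_all
    ultimately show "(\<gamma>, \<tau>) \<in> curve_rel L M k a"
      unfolding curve_rel_iff by (intro conjI exI[of _ "min \<epsilon> \<delta>"])
  qed
qed

lemma curve_relD:
  assumes "(\<gamma>, \<gamma>') \<in> curve_rel L M k a"
  shows "near0 (\<lambda>t. sup_ball a t \<inter> trace \<gamma> = sup_ball a t \<inter> trace \<gamma>')"
proof -
  obtain \<epsilon> where \<epsilon>: "0 < \<epsilon>" "sup_ball a \<epsilon> \<inter> trace \<gamma> = sup_ball a \<epsilon> \<inter> trace \<gamma>'"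
    using assms unfolding curve_rel_iff by (elim exE conjE)
  have "sup_ball a t \<inter> trace \<gamma> = sup_ball a t \<inter> trace \<gamma>'" if "t < \<epsilon>" for t
    by (rule sup_ball_Int_eq_mono[OF \<epsilon>(2)]) (use that in simp)
  then show ?thesis
    unfolding near0_def using \<epsilon>(1) by (intro exI[of _ \<epsilon>]) simp
qed

text \<open>Equivalent curves cut out the same sets from all sufficiently small balls, so the two
  distance functions coincide near 0.\<close>

lemma germ0_local_dist_cong:
  assumes "(\<gamma>, \<gamma>') \<in> curve_rel L M k a" "(\<sigma>, \<sigma>') \<in> curve_rel L M k a"
  shows "germ0 L M (local_dist a \<gamma> \<sigma>) = germ0 L M (local_dist a \<gamma>' \<sigma>')"
proof (rule germ0_cong)
  from near0_conj[OF assms[THEN curve_relD]]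
  show "near0 (\<lambda>t. local_dist a \<gamma> \<sigma> t = local_dist a \<gamma>' \<sigma>' t)"
    by (rule near0_mono) (simp only: local_dist_def)
qed

lemma curve_germ_self: "\<gamma> \<in> curves_at L M k a \<Longrightarrow> \<gamma> \<in> curve_germ L M k a \<gamma>"
  unfolding curve_germ_def by (rule equiv_class_self[OF equiv_curve_rel])

text \<open>By independence of representatives the union in \<open>germ_dist\<close> collapses to a
  singleton, nonempty because \<gamma> and \<sigma> represent their own classes.\<close>

lemma germ_dist_curve_germ:
  assumes "\<gamma> \<in> curves_at L M k a" "\<sigma> \<in> curves_at L M k a"
  shows "germ_dist L M a (curve_germ L M k a \<gamma>) (curve_germ L M k a \<sigma>)
    = germ0 L M (local_dist a \<gamma> \<sigma>)"
proof -
  have const: "germ0 L M (local_dist a \<gamma>' \<sigma>') = germ0 L M (local_dist a \<gamma> \<sigma>)"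
    if "\<gamma>' \<in> curve_germ L M k a \<gamma>" "\<sigma>' \<in> curve_germ L M k a \<sigma>" for \<gamma>' \<sigma>'
    using that unfolding curve_germ_def Image_singleton_iff
    by (intro germ0_local_dist_cong[symmetric])
  have "(\<Union>\<gamma>'\<in>curve_germ L M k a \<gamma>. \<Union>\<sigma>'\<in>curve_germ L M k a \<sigma>.
      {germ0 L M (local_dist a \<gamma>' \<sigma>')}) =
      (\<Union>\<gamma>'\<in>curve_germ L M k a \<gamma>. \<Union>\<sigma>'\<in>curve_germ L M k a \<sigma>. {germ0 L M (local_dist a \<gamma> \<sigma>)})"
    by (intro SUP_cong refl) (simp only: const)
  also have "\<dots> = {germ0 L M (local_dist a \<gamma> \<sigma>)}"
    using curve_germ_self[OF assms(1)] curve_germ_self[OF assms(2)] by blast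
  finally show ?thesis by (simp only: germ_dist_def the_elem_eq)
qed

lemma curve_germsE:
  assumes "g \<in> curve_germs L M k a"
  obtains \<gamma> where "\<gamma> \<in> curves_at L M k a" "g = curve_germ L M k a \<gamma>"
  using assms unfolding curve_germs_def
  by (rule quotientE) (rule that, simp_all add: curve_germ_def)

text \<open>The center lies in every ball around it, so equivalent curves agree on whether they meet
  it and any representative decides.\<close>

lemma passes_through_center_curve_germ:
  assumes "\<gamma> \<in> curves_at L M k a"
  shows "passes_through_center a (curve_germ L M k a \<gamma>) \<longleftrightarrow> a \<in> trace \<gamma>"
proof
  assume "passes_through_center a (curve_germ L M k a \<gamma>)"
  then obtain \<gamma>' where "a \<in> trace \<gamma>'" "(\<gamma>, \<gamma>') \<in> curve_rel L M k a"
    unfolding passes_through_center_def curve_germ_def by auto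
  moreover from this(2) obtain \<epsilon> where "0 < \<epsilon>" "sup_ball a \<epsilon> \<inter> trace \<gamma> = sup_ball a \<epsilon> \<inter> trace \<gamma>'"
    unfolding curve_rel_iff by (elim exE conjE)
  ultimately show "a \<in> trace \<gamma>"
    using center_in_sup_ball[of \<epsilon> a] by blast
next
  assume "a \<in> trace \<gamma>"
  then show "passes_through_center a (curve_germ L M k a \<gamma>)"
    unfolding passes_through_center_def using curve_germ_self[OF assms] by (intro bexI[of _ \<gamma>])
qed

lemma same_off_center_curve_rel:
  assumes "\<gamma> \<in> curves_at L M k a" "\<sigma> \<in> curves_at L M k a" "same_off_center a \<gamma> \<sigma>"
    and "a \<in> trace \<gamma> \<longleftrightarrow> a \<in> trace \<sigma>"
  shows "(\<gamma>, \<sigma>) \<in> curve_rel L M k a"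
proof -
  obtain \<epsilon> where "0 < \<epsilon>" "sup_ball a \<epsilon> \<inter> trace \<gamma> - {a} = sup_ball a \<epsilon> \<inter> trace \<sigma> - {a}"
    using assms(3) unfolding same_off_center_def by (elim exE conjE)
  moreover from this(2) have "sup_ball a \<epsilon> \<inter> trace \<gamma> = sup_ball a \<epsilon> \<inter> trace \<sigma>"
    using assms(4) by blast
  ultimately show ?thesis
    using assms(1,2) unfolding curve_rel_iff by (intro conjI exI[of _ \<epsilon>])
qed

lemma pseudometric_over_subset:
  "pseudometric_over K S d \<Longrightarrow> S' \<subseteq> S \<Longrightarrow> pseudometric_over K S' d"
  unfolding pseudometric_over_def subset_iff by (intro conjI ballI; elim conjE; simp)

context o_minimal_expansion
begin

section \<open>The distance of two curves at a fixed radius\<close>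

lemma curves_at_limit:
  assumes "\<gamma> \<in> curves_at L M k a" "0 < \<epsilon>"
  obtains p where "0 < p" "p < 1" "sup_dist a (\<gamma> p) < \<epsilon>"
proof -
  have "near0 (\<lambda>t. sup_dist a (\<gamma> t) < \<epsilon>)"
    using assms by (simp add: curves_at_def)
  then obtain c where c: "0 < c" "\<forall>t. 0 < t \<and> t < c \<longrightarrow> sup_dist a (\<gamma> t) < \<epsilon>"
    unfolding near0_def by (elim exE conjE)
  then have "0 < min c 1" by simp
  then obtain p where "0 < p" "p < min c 1"
    using dense by blast
  then show thesis using c(2) by (intro that[of p]) simp_all
qed

lemma sup_ball_Int_trace_nonempty:
  assumes "\<gamma> \<in> curves_at L M k a" "length a = k" "0 < t"
  shows "sup_ball a t \<inter> trace \<gamma> \<noteq> {}"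
proof -
  obtain p where p: "0 < p" "p < 1" "sup_dist a (\<gamma> p) < t"
    by (rule curves_at_limit[OF assms(1,3)], rule that)
  then have "\<gamma> p \<in> sup_ball a t \<inter> trace \<gamma>"
    using assms(1,2) by (simp add: sup_ball_def trace_def curves_at_def)
  then show ?thesis by blast
qed

lemma local_dist_ex1:
  assumes "\<gamma> \<in> curves_at L M k a" "\<sigma> \<in> curves_at L M k a" "length a = k" "0 < t"
  shows "\<exists>!r. is_hausdorff_dist (sup_ball a t \<inter> trace \<gamma>) (sup_ball a t \<inter> trace \<sigma>) r"
proof (rule ex_ex1I)
  show "\<exists>r. is_hausdorff_dist (sup_ball a t \<inter> trace \<gamma>) (sup_ball a t \<inter> trace \<sigma>) r"
    by (rule is_hausdorff_dist_ex[OF def_curve_extend_curve[OF assms(1,3)]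
        def_curve_extend_curve[OF assms(2,3)] assms(3), of t, unfolded trace_extend_curve,
        OF sup_ball_Int_trace_nonempty[OF assms(1,3,4)] sup_ball_Int_trace_nonempty[OF assms(2,3,4)]])
qed (rule is_hausdorff_dist_unique)

text \<open>The working description of \<open>local_dist\<close>: metric laws, definability and the
  criterion for vanishing are all derived from it.\<close>

lemma local_dist_le_iff:
  assumes "\<gamma> \<in> curves_at L M k a" "\<sigma> \<in> curves_at L M k a" "length a = k" "0 < t"
  shows "local_dist a \<gamma> \<sigma> t \<le> s \<longleftrightarrow>
    hausdorff_semidist_le (sup_ball a t \<inter> trace \<gamma>) (sup_ball a t \<inter> trace \<sigma>) s \<and>
    hausdorff_semidist_le (sup_ball a t \<inter> trace \<sigma>) (sup_ball a t \<inter> trace \<gamma>) s"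
  unfolding local_dist_def hausdorff_dist_def
  by (rule is_hausdorff_dist_le_iff[OF theI'[OF local_dist_ex1[OF assms]]])

lemma local_dist_nonneg:
  assumes "\<gamma> \<in> curves_at L M k a" "\<sigma> \<in> curves_at L M k a" "length a = k" "0 < t"
  shows "0 \<le> local_dist a \<gamma> \<sigma> t"
proof (rule hausdorff_semidist_le_nonneg)
  show "hausdorff_semidist_le (sup_ball a t \<inter> trace \<gamma>) (sup_ball a t \<inter> trace \<sigma>) (local_dist a \<gamma> \<sigma> t)"
    using local_dist_le_iff[OF assms, of "local_dist a \<gamma> \<sigma> t"] by simp
qed (rule sup_ball_Int_trace_nonempty[OF assms(1,3,4)])

lemma local_dist_commute:
  assumes "\<gamma> \<in> curves_at L M k a" "\<sigma> \<in> curves_at L M k a" "length a = k" "0 < t"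
  shows "local_dist a \<gamma> \<sigma> t = local_dist a \<sigma> \<gamma> t"
  using local_dist_le_iff[OF assms, of "local_dist a \<sigma> \<gamma> t"]
    local_dist_le_iff[OF assms, of "local_dist a \<gamma> \<sigma> t"]
    local_dist_le_iff[OF assms(2,1,3,4), of "local_dist a \<sigma> \<gamma> t"]
    local_dist_le_iff[OF assms(2,1,3,4), of "local_dist a \<gamma> \<sigma> t"] by simp

lemma local_dist_triangle:
  assumes "\<gamma> \<in> curves_at L M k a" "\<sigma> \<in> curves_at L M k a" "\<tau> \<in> curves_at L M k a"
    "length a = k" "0 < t"
  shows "local_dist a \<gamma> \<tau> t \<le> local_dist a \<gamma> \<sigma> t + local_dist a \<sigma> \<tau> t"
proof -
  have len: "length x = length y" if "x \<in> sup_ball a t \<inter> A" "y \<in> sup_ball a t \<inter> B" for x y A B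
    using that by (simp add: sup_ball_def)
  have le: "hausdorff_semidist_le (sup_ball a t \<inter> trace \<gamma>) (sup_ball a t \<inter> trace \<sigma>) (local_dist a \<gamma> \<sigma> t)"
    "hausdorff_semidist_le (sup_ball a t \<inter> trace \<sigma>) (sup_ball a t \<inter> trace \<gamma>) (local_dist a \<gamma> \<sigma> t)"
    using local_dist_le_iff[OF assms(1,2,4,5), of "local_dist a \<gamma> \<sigma> t"] by simp_all
  have le': "hausdorff_semidist_le (sup_ball a t \<inter> trace \<sigma>) (sup_ball a t \<inter> trace \<tau>) (local_dist a \<sigma> \<tau> t)"
    "hausdorff_semidist_le (sup_ball a t \<inter> trace \<tau>) (sup_ball a t \<inter> trace \<sigma>) (local_dist a \<sigma> \<tau> t)"
    using local_dist_le_iff[OF assms(2,3,4,5), of "local_dist a \<sigma> \<tau> t"] by simp_all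
  have "hausdorff_semidist_le (sup_ball a t \<inter> trace \<gamma>) (sup_ball a t \<inter> trace \<tau>)
      (local_dist a \<gamma> \<sigma> t + local_dist a \<sigma> \<tau> t)"
    by (rule hausdorff_semidist_le_trans[OF le(1) le'(1)]) (rule len)
  moreover have "hausdorff_semidist_le (sup_ball a t \<inter> trace \<tau>) (sup_ball a t \<inter> trace \<gamma>)
      (local_dist a \<sigma> \<tau> t + local_dist a \<gamma> \<sigma> t)"
    by (rule hausdorff_semidist_le_trans[OF le'(2) le(2)]) (rule len)
  ultimately show ?thesis
    unfolding local_dist_le_iff[OF assms(1,3,4,5)] by (simp add: add.commute)
qed

text \<open>For t \<le> 0 both sets are empty and no Hausdorff distance exists. The value 0 is
  chosen there, which leaves the germ unchanged.\<close>

lemma definable_local_dist: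
  assumes "\<gamma> \<in> curves_at L M k a" "\<sigma> \<in> curves_at L M k a" "length a = k"
  shows "definable_fun L M (\<lambda>t. if 0 < t then local_dist a \<gamma> \<sigma> t else 0)"
proof -
  note semidist = def_pred_hausdorff_semidist_le[OF def_curve_extend_curve[OF assms(1,3)]
      def_curve_extend_curve[OF assms(2,3)] assms(3), unfolded trace_extend_curve]
    def_pred_hausdorff_semidist_le[OF def_curve_extend_curve[OF assms(2,3)]
      def_curve_extend_curve[OF assms(1,3)] assms(3), unfolded trace_extend_curve]
  \<comment> \<open>Determining a value by its upper bounds expresses the graph of
    \<open>local_dist\<close> through definable semidistance conditions instead of its definite
    description.\<close>
  have eq_iff: "y = l \<longleftrightarrow> (\<forall>s. y \<le> s \<longleftrightarrow> l \<le> s)" for y l :: 'm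
    by (metis order_antisym order_refl)
  have eq: "v 0 = (if 0 < v (Suc 0) then local_dist a \<gamma> \<sigma> (v (Suc 0)) else 0) \<longleftrightarrow>
    (0 < v (Suc 0) \<longrightarrow> (\<forall>s. v 0 \<le> s \<longleftrightarrow>
      hausdorff_semidist_le (sup_ball a (v (Suc 0)) \<inter> trace \<gamma>) (sup_ball a (v (Suc 0)) \<inter> trace \<sigma>) s \<and>
      hausdorff_semidist_le (sup_ball a (v (Suc 0)) \<inter> trace \<sigma>) (sup_ball a (v (Suc 0)) \<inter> trace \<gamma>) s)) \<and>
    (\<not> 0 < v (Suc 0) \<longrightarrow> v 0 = 0)" for v
  proof (cases "0 < v (Suc 0)")
    case True
    then show ?thesis
      by (simp only: if_True not_True_eq_False simp_thms
          local_dist_le_iff[OF assms True, symmetric] eq_iff[of "v 0" "local_dist a \<gamma> \<sigma> (v (Suc 0))"])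
  qed simp
  show ?thesis
    unfolding definable_fun_iff def_fun_def eq
    by (intro def_intros semidist)
qed

lemma germ0_local_dist:
  "germ0 L M (local_dist a \<gamma> \<sigma>) = germ0 L M (\<lambda>t. if 0 < t then local_dist a \<gamma> \<sigma> t else 0)"
  by (intro germ0_cong near0_pos) simp

section \<open>Vanishing of the distance\<close>

lemma adherent_point_in_curve:
  assumes \<gamma>: "\<gamma> \<in> curves_at L M k a" and a: "length a = k"
  obtains \<epsilon> where "0 < \<epsilon>" "\<forall>x. length x = k \<and> x \<noteq> a \<and> sup_dist a x < \<epsilon> \<and>
    (\<forall>\<eta>>0. \<exists>y\<in>trace \<gamma>. sup_dist x y < \<eta>) \<longrightarrow> x \<in> trace \<gamma>"
proof -
  define \<gamma>' where "\<gamma>' = extend_curve a \<gamma>"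
  have \<gamma>': "def_curve k \<gamma>'"
    unfolding \<gamma>'_def by (rule def_curve_extend_curve[OF \<gamma> a])
  have cont: "\<exists>\<delta>>0. \<forall>s. 0 < s \<and> s < 1 \<and> \<bar>s - t\<bar> < \<delta> \<longrightarrow> sup_dist (\<gamma>' t) (\<gamma>' s) < \<epsilon>"
    if "0 < t" "t < 1" "0 < \<epsilon>" for t \<epsilon>
  proof -
    have "\<forall>t\<in>{0<..<1}. \<forall>\<epsilon>>0. \<exists>\<delta>>0. \<forall>s\<in>{0<..<1}. \<bar>s - t\<bar> < \<delta> \<longrightarrow> sup_dist (\<gamma> t) (\<gamma> s) < \<epsilon>"
      using \<gamma> unfolding curves_at_def mem_Collect_eq by (elim conjE)
    moreover have "t \<in> {0<..<1}"
      using that by simp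
    ultimately obtain \<delta> where "0 < \<delta>"
      "\<forall>s\<in>{0<..<1}. \<bar>s - t\<bar> < \<delta> \<longrightarrow> sup_dist (\<gamma> t) (\<gamma> s) < \<epsilon>"
      using \<open>0 < \<epsilon>\<close> by blast
    then show ?thesis
      using that by (intro exI[of _ \<delta>]) (simp add: \<gamma>'_def extend_curve_def)
  qed
  have lim: "near0 (\<lambda>t. sup_dist a (\<gamma>' t) < \<epsilon>)" if "0 < \<epsilon>" for \<epsilon>
  proof -
    have "near0 (\<lambda>t. sup_dist a (\<gamma> t) < \<epsilon>)"
      using \<gamma> that by (simp add: curves_at_def)
    moreover have "sup_dist a a < \<epsilon>"
      using that by (simp add: sup_dist_less_iff)
    then have "sup_dist a (\<gamma>' t) < \<epsilon>" if "sup_dist a (\<gamma> t) < \<epsilon>" for t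
      using that by (simp add: \<gamma>'_def extend_curve_def)
    ultimately show ?thesis
      by (rule near0_mono)
  qed
  \<comment> \<open>If the limit at 1 is some b \<noteq> a, the open ball of radius
    \<open>sup_dist a b\<close> just excludes it; otherwise any radius works, here 1.\<close>
  have "\<exists>\<epsilon>>0. \<forall>x. length x = k \<and> x \<noteq> a \<and> sup_dist a x < \<epsilon> \<longrightarrow> \<not> limit_at_1 \<gamma>' x"
  proof (cases "\<exists>b. length b = k \<and> b \<noteq> a \<and> limit_at_1 \<gamma>' b")
    case True
    then obtain b where b: "length b = k" "b \<noteq> a" "limit_at_1 \<gamma>' b"
      by blast
    have "0 < sup_dist a b"
      using b a sup_dist_eq_0_iff[of a b] sup_dist_nonneg[of a b] by simp
    moreover have "\<not> limit_at_1 \<gamma>' x" if "length x = k" "sup_dist a x < sup_dist a b" for x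
    proof
      assume "limit_at_1 \<gamma>' x"
      then have "x = b"
        using b(3) def_curve_length[OF \<gamma>'] that(1) b(1) by (rule limit_at_1_unique)
      then show False using that(2) by simp
    qed
    ultimately show ?thesis
      by (intro exI[of _ "sup_dist a b"]) simp
  next
    case False
    then show ?thesis by (intro exI[of _ 1]) auto
  qed
  then obtain \<epsilon> where \<epsilon>: "0 < \<epsilon>"
    "\<forall>x. length x = k \<and> x \<noteq> a \<and> sup_dist a x < \<epsilon> \<longrightarrow> \<not> limit_at_1 \<gamma>' x"
    by (elim exE conjE)
  have "x \<in> trace \<gamma>" if x: "length x = k" "x \<noteq> a" "sup_dist a x < \<epsilon>"
    and adh: "\<forall>\<eta>>0. \<exists>y\<in>trace \<gamma>. sup_dist x y < \<eta>" for x
  proof -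
    have "\<exists>s. 0 < s \<and> s < 1 \<and> sup_dist x (\<gamma>' s) < \<eta>" if "0 < \<eta>" for \<eta>
    proof -
      obtain y where "y \<in> trace \<gamma>'" "sup_dist x y < \<eta>"
        using adh \<open>0 < \<eta>\<close> unfolding \<gamma>'_def trace_extend_curve by blast
      then show ?thesis by (auto simp: trace_def)
    qed
    moreover have "\<not> limit_at_1 \<gamma>' x"
      using \<epsilon>(2) x by simp
    ultimately have "x \<in> trace \<gamma>'"
      by (intro adherent_point_in_trace[OF \<gamma>' a x(1,2) cont lim])
    then show ?thesis by (simp add: \<gamma>'_def trace_extend_curve)
  qed
  then have "\<forall>x. length x = k \<and> x \<noteq> a \<and> sup_dist a x < \<epsilon> \<and>
      (\<forall>\<eta>>0. \<exists>y\<in>trace \<gamma>. sup_dist x y < \<eta>) \<longrightarrow> x \<in> trace \<gamma>"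
    by (intro allI impI; elim conjE)
  with \<epsilon>(1) show thesis by (rule that)
qed

text \<open>With bound 0 only the slack \<epsilon> remains, so each point of A in the ball is
  approximated arbitrarily well by points of B. The center is removed because \<open>closed\<close>
  does not cover it.\<close>

lemma semidist_0_imp_subset:
  assumes "hausdorff_semidist_le (sup_ball a t \<inter> A) (sup_ball a t \<inter> B) 0" "t \<le> \<epsilon>"
    and closed: "\<forall>x. length x = length a \<and> x \<noteq> a \<and> sup_dist a x < \<epsilon> \<and>
      (\<forall>\<eta>>0. \<exists>y\<in>B. sup_dist x y < \<eta>) \<longrightarrow> x \<in> B"
  shows "sup_ball a t \<inter> A - {a} \<subseteq> sup_ball a t \<inter> B - {a}"
proof
  fix x assume x: "x \<in> sup_ball a t \<inter> A - {a}"
  have "x \<in> B"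
  proof (intro closed[rule_format] conjI allI impI)
    show "length x = length a" "x \<noteq> a" "sup_dist a x < \<epsilon>"
      using x assms(2) by (auto simp: sup_ball_def)
    show "\<exists>y\<in>B. sup_dist x y < \<eta>" if "0 < \<eta>" for \<eta>
      using assms(1) x that unfolding hausdorff_semidist_le_def by fastforce
  qed
  with x show "x \<in> sup_ball a t \<inter> B - {a}" by blast
qed

lemma same_off_center_semidist_0:
  assumes "\<sigma> \<in> curves_at L M k a" "length a = k" "0 < t"
    and sub: "sup_ball a t \<inter> A - {a} \<subseteq> trace \<sigma>"
  shows "hausdorff_semidist_le (sup_ball a t \<inter> A) (sup_ball a t \<inter> trace \<sigma>) 0"
  unfolding hausdorff_semidist_le_def
proof (intro ballI allI impI)
  fix x and \<epsilon> :: 'm assume x: "x \<in> sup_ball a t \<inter> A" and \<epsilon>: "0 < \<epsilon>"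
  show "\<exists>y\<in>sup_ball a t \<inter> trace \<sigma>. sup_dist x y < 0 + \<epsilon>"
  proof (cases "x = a")
    case True
    \<comment> \<open>The center need not lie on \<sigma>, but \<sigma> tends to it; this is why the
      distance cannot tell whether a curve passes through a.\<close>
    have "sup_ball a (min t \<epsilon>) \<inter> trace \<sigma> \<noteq> {}"
      using assms(3) \<epsilon> by (intro sup_ball_Int_trace_nonempty[OF assms(1,2)]) simp
    then show ?thesis
      using True by (auto simp: sup_ball_def)
  next
    case False
    then have "x \<in> sup_ball a t \<inter> trace \<sigma>"
      using x sub by blast
    moreover have "sup_dist x x < 0 + \<epsilon>"
      using \<epsilon> by (simp add: sup_dist_less_iff)
    ultimately show ?thesis by blast
  qed
qed

lemma definable_fun_const: "definable_fun L M (\<lambda>_. c)"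
  unfolding definable_fun_iff by (rule def_fun_const)

lemma germ0_local_dist_eq_0_iff:
  assumes \<gamma>: "\<gamma> \<in> curves_at L M k a" and \<sigma>: "\<sigma> \<in> curves_at L M k a" and a: "length a = k"
  shows "germ0 L M (local_dist a \<gamma> \<sigma>) = germ0 L M (\<lambda>_. 0) \<longleftrightarrow> same_off_center a \<gamma> \<sigma>"
proof
  assume "germ0 L M (local_dist a \<gamma> \<sigma>) = germ0 L M (\<lambda>_. 0)"
  then have "(\<lambda>_. 0) \<in> germ0 L M (local_dist a \<gamma> \<sigma>)"
    using germ0_self[OF definable_fun_const] by simp
  then obtain c where c: "0 < c" "\<And>t. 0 < t \<Longrightarrow> t < c \<Longrightarrow> local_dist a \<gamma> \<sigma> t = 0"
    unfolding germ0_def near0_def by blast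
  obtain \<epsilon> where \<epsilon>: "0 < \<epsilon>" "\<forall>x. length x = k \<and> x \<noteq> a \<and> sup_dist a x < \<epsilon> \<and>
    (\<forall>\<eta>>0. \<exists>y\<in>trace \<gamma>. sup_dist x y < \<eta>) \<longrightarrow> x \<in> trace \<gamma>"
    by (rule adherent_point_in_curve[OF \<gamma> a], rule that)
  obtain \<delta> where \<delta>: "0 < \<delta>" "\<forall>x. length x = k \<and> x \<noteq> a \<and> sup_dist a x < \<delta> \<and>
    (\<forall>\<eta>>0. \<exists>y\<in>trace \<sigma>. sup_dist x y < \<eta>) \<longrightarrow> x \<in> trace \<sigma>"
    by (rule adherent_point_in_curve[OF \<sigma> a], rule that)
  \<comment> \<open>One radius t suffices: below c the distance vanishes, below \<epsilon> and
    \<delta> both traces contain their adherent points other than a.\<close>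
  have "0 < min c (min \<epsilon> \<delta>)"
    using c(1) \<epsilon>(1) \<delta>(1) by simp
  then obtain t where t: "0 < t" "t < min c (min \<epsilon> \<delta>)"
    using dense by blast
  then have "local_dist a \<gamma> \<sigma> t \<le> 0"
    using c(2)[of t] by simp
  then have le: "hausdorff_semidist_le (sup_ball a t \<inter> trace \<gamma>) (sup_ball a t \<inter> trace \<sigma>) 0"
    "hausdorff_semidist_le (sup_ball a t \<inter> trace \<sigma>) (sup_ball a t \<inter> trace \<gamma>) 0"
    unfolding local_dist_le_iff[OF \<gamma> \<sigma> a t(1)] by simp_all
  have "t \<le> \<epsilon>" "t \<le> \<delta>"
    using t(2) by simp_all
  then have "sup_ball a t \<inter> trace \<gamma> - {a} = sup_ball a t \<inter> trace \<sigma> - {a}"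
    by (intro subset_antisym semidist_0_imp_subset[OF le(1) _ \<delta>(2)[folded a]]
        semidist_0_imp_subset[OF le(2) _ \<epsilon>(2)[folded a]])
  then show "same_off_center a \<gamma> \<sigma>"
    unfolding same_off_center_def using t(1) by blast
next
  assume "same_off_center a \<gamma> \<sigma>"
  then obtain \<epsilon> where \<epsilon>: "0 < \<epsilon>"
    "sup_ball a \<epsilon> \<inter> trace \<gamma> - {a} = sup_ball a \<epsilon> \<inter> trace \<sigma> - {a}"
    unfolding same_off_center_def by blast
  have "local_dist a \<gamma> \<sigma> t = 0" if t: "0 < t" "t < \<epsilon>" for t
  proof -
    have "sup_ball a t \<subseteq> sup_ball a \<epsilon>"
      using t(2) by (intro sup_ball_mono) simp
    then have "sup_ball a t \<inter> trace \<gamma> - {a} \<subseteq> trace \<sigma>" "sup_ball a t \<inter> trace \<sigma> - {a} \<subseteq> trace \<gamma>"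
      using \<epsilon>(2) by blast+
    then have "local_dist a \<gamma> \<sigma> t \<le> 0"
      unfolding local_dist_le_iff[OF \<gamma> \<sigma> a t(1)]
      by (intro conjI same_off_center_semidist_0[OF \<sigma> a t(1)] same_off_center_semidist_0[OF \<gamma> a t(1)])
    then show ?thesis
      using local_dist_nonneg[OF \<gamma> \<sigma> a t(1)] by simp
  qed
  then have "near0 (\<lambda>t. local_dist a \<gamma> \<sigma> t = 0)"
    unfolding near0_def using \<epsilon>(1) by blast
  then show "germ0 L M (local_dist a \<gamma> \<sigma>) = germ0 L M (\<lambda>_. 0)"
    by (rule germ0_cong)
qed

section \<open>The metric over the Hardy field\<close>

lemma germ_dist_well_defined:
  assumes a: "length a = k"
  shows "germ_dist_well_defined L M k a"
  unfolding germ_dist_well_defined_def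
proof (intro conjI ballI)
  fix \<gamma> \<sigma> assume *: "\<gamma> \<in> curves_at L M k a" "\<sigma> \<in> curves_at L M k a"
  show "near0 (\<lambda>t. \<exists>!r. is_hausdorff_dist (sup_ball a t \<inter> trace \<gamma>) (sup_ball a t \<inter> trace \<sigma>) r)"
    by (rule near0_pos) (rule local_dist_ex1[OF * a])
  show "germ0 L M (local_dist a \<gamma> \<sigma>) \<in> carrier (hardy_field L M)"
    unfolding germ0_local_dist using definable_local_dist[OF * a] by (auto simp: hardy_field_def)
  show "germ_dist L M a (curve_germ L M k a \<gamma>) (curve_germ L M k a \<sigma>)
      = germ0 L M (local_dist a \<gamma> \<sigma>)"
    by (rule germ_dist_curve_germ[OF *])
next
  show "(\<lambda>\<gamma> \<sigma>. germ0 L M (local_dist a \<gamma> \<sigma>)) respects2 curve_rel L M k a"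
    by (rule congruent2I') (rule germ0_local_dist_cong)
qed (rule equiv_curve_rel)

lemma germ_dist_eq_0_iff:
  assumes "\<gamma> \<in> curves_at L M k a" "\<sigma> \<in> curves_at L M k a" "length a = k"
  shows "germ_dist L M a (curve_germ L M k a \<gamma>) (curve_germ L M k a \<sigma>) = \<zero>\<^bsub>hardy_field L M\<^esub>
    \<longleftrightarrow> same_off_center a \<gamma> \<sigma>"
  using germ0_local_dist_eq_0_iff[OF assms]
  by (simp add: germ_dist_curve_germ[OF assms(1,2)] hardy_field_def)

lemma pseudometric_germ_dist:
  assumes a: "length a = k"
  shows "pseudometric_over (hardy_field L M) (curve_germs L M k a) (germ_dist L M a)"
  unfolding pseudometric_over_def
proof (intro conjI ballI)
  \<comment> \<open>Order and addition of the Hardy field are defined through definable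
    representatives; \<open>?d\<close> is the explicit one used as witness throughout.\<close>
  let ?d = "\<lambda>\<gamma> \<sigma> t. if 0 < t then local_dist a \<gamma> \<sigma> t else 0"
  fix g assume "g \<in> curve_germs L M k a"
  then obtain \<gamma> where \<gamma>: "\<gamma> \<in> curves_at L M k a" and g: "g = curve_germ L M k a \<gamma>"
    by (rule curve_germsE)
  have "same_off_center a \<gamma> \<gamma>"
    unfolding same_off_center_def by (intro exI[of _ 1]) simp
  then show "germ_dist L M a g g = \<zero>\<^bsub>hardy_field L M\<^esub>"
    unfolding g using germ_dist_eq_0_iff[OF \<gamma> \<gamma> a] by simp
  fix h assume "h \<in> curve_germs L M k a"
  then obtain \<sigma> where \<sigma>: "\<sigma> \<in> curves_at L M k a" and h: "h = curve_germ L M k a \<sigma>"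
    by (rule curve_germsE)
  note gh = germ_dist_curve_germ[OF \<gamma> \<sigma>, folded g h] germ_dist_curve_germ[OF \<sigma> \<gamma>, folded g h]
  show "germ_dist L M a g h \<in> carrier (hardy_field L M)"
    unfolding gh germ0_local_dist using definable_local_dist[OF \<gamma> \<sigma> a] by (auto simp: hardy_field_def)
  have "?d \<gamma> \<sigma> \<in> germ_dist L M a g h"
    unfolding gh germ0_local_dist by (rule germ0_self[OF definable_local_dist[OF \<gamma> \<sigma> a]])
  moreover have "(\<lambda>_. 0) \<in> germ0 L M (\<lambda>_. 0)"
    by (rule germ0_self[OF definable_fun_const])
  moreover have "near0 (\<lambda>t. 0 \<le> ?d \<gamma> \<sigma> t)"
    using local_dist_nonneg[OF \<gamma> \<sigma> a] by (intro near0_pos) simp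
  ultimately have "\<exists>f\<in>germ0 L M (\<lambda>_. 0). \<exists>f'\<in>germ_dist L M a g h. near0 (\<lambda>t. f t \<le> f' t)"
    by (intro bexI)
  then show "rle (hardy_field L M) \<zero>\<^bsub>hardy_field L M\<^esub> (germ_dist L M a g h)"
    by (simp add: hardy_field_def)
  show "germ_dist L M a g h = germ_dist L M a h g"
    unfolding gh by (intro germ0_cong near0_pos local_dist_commute[OF \<gamma> \<sigma> a])
  fix j assume "j \<in> curve_germs L M k a"
  then obtain \<tau> where \<tau>: "\<tau> \<in> curves_at L M k a" and j: "j = curve_germ L M k a \<tau>"
    by (rule curve_germsE)
  have mem: "?d \<gamma> \<sigma> \<in> germ_dist L M a g h" "?d \<sigma> \<tau> \<in> germ_dist L M a h j"
    "?d \<gamma> \<tau> \<in> germ_dist L M a g j"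
    using germ0_self[OF definable_local_dist[OF \<gamma> \<sigma> a]] germ0_self[OF definable_local_dist[OF \<sigma> \<tau> a]]
      germ0_self[OF definable_local_dist[OF \<gamma> \<tau> a]]
    by (simp_all only: g h j germ_dist_curve_germ \<gamma> \<sigma> \<tau> germ0_local_dist)
  have "definable_fun L M (\<lambda>t. ?d \<gamma> \<sigma> t + ?d \<sigma> \<tau> t)"
    using definable_local_dist[OF \<gamma> \<sigma> a] definable_local_dist[OF \<sigma> \<tau> a]
    unfolding definable_fun_iff by (rule def_fun_add)
  then have "(\<lambda>t. ?d \<gamma> \<sigma> t + ?d \<sigma> \<tau> t) \<in> germ0 L M (\<lambda>t. ?d \<gamma> \<sigma> t + ?d \<sigma> \<tau> t)"
    by (rule germ0_self)
  then have "(\<lambda>t. ?d \<gamma> \<sigma> t + ?d \<sigma> \<tau> t) \<in> germ_dist L M a g h \<oplus>\<^bsub>hardy_field L M\<^esub> germ_dist L M a h j"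
    using mem(1,2) unfolding hardy_field_def ring.simps by (intro UN_I)
  moreover have "near0 (\<lambda>t. ?d \<gamma> \<tau> t \<le> ?d \<gamma> \<sigma> t + ?d \<sigma> \<tau> t)"
    using local_dist_triangle[OF \<gamma> \<sigma> \<tau> a] by (intro near0_pos) simp
  ultimately have "\<exists>f\<in>germ_dist L M a g j.
      \<exists>f'\<in>germ_dist L M a g h \<oplus>\<^bsub>hardy_field L M\<^esub> germ_dist L M a h j. near0 (\<lambda>t. f t \<le> f' t)"
    using mem(3) by (intro bexI)
  moreover have "rle (hardy_field L M) F G \<longleftrightarrow> (\<exists>f\<in>F. \<exists>f'\<in>G. near0 (\<lambda>t. f t \<le> f' t))" for F G
    by (simp add: hardy_field_def)
  ultimately show "rle (hardy_field L M) (germ_dist L M a g j)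
      (germ_dist L M a g h \<oplus>\<^bsub>hardy_field L M\<^esub> germ_dist L M a h j)"
    by (simp only:)
qed

text \<open>Fixing whether the trace contains a removes the only ambiguity left by
  \<open>same_off_center\<close>. The Boolean b treats the two resulting families of germs at
  once.\<close>

lemma metric_germ_dist:
  assumes a: "length a = k"
  shows "metric_over (hardy_field L M)
    {g \<in> curve_germs L M k a. passes_through_center a g \<longleftrightarrow> b} (germ_dist L M a)"
  unfolding metric_over_def
proof (intro conjI ballI)
  show pseudo: "pseudometric_over (hardy_field L M)
      {g \<in> curve_germs L M k a. passes_through_center a g \<longleftrightarrow> b} (germ_dist L M a)"
    by (rule pseudometric_over_subset[OF pseudometric_germ_dist[OF a]]) blast
  fix g h
  assume gS: "g \<in> {g \<in> curve_germs L M k a. passes_through_center a g \<longleftrightarrow> b}"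
    and hS: "h \<in> {g \<in> curve_germs L M k a. passes_through_center a g \<longleftrightarrow> b}"
  obtain \<gamma> where \<gamma>: "\<gamma> \<in> curves_at L M k a" and g: "g = curve_germ L M k a \<gamma>"
    using gS by (blast elim: curve_germsE)
  obtain \<sigma> where \<sigma>: "\<sigma> \<in> curves_at L M k a" and h: "h = curve_germ L M k a \<sigma>"
    using hS by (blast elim: curve_germsE)
  show "germ_dist L M a g h = \<zero>\<^bsub>hardy_field L M\<^esub> \<longleftrightarrow> g = h"
  proof
    assume "germ_dist L M a g h = \<zero>\<^bsub>hardy_field L M\<^esub>"
    then have "same_off_center a \<gamma> \<sigma>"
      unfolding g h germ_dist_eq_0_iff[OF \<gamma> \<sigma> a] .
    moreover have "a \<in> trace \<gamma> \<longleftrightarrow> a \<in> trace \<sigma>"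
      using gS hS passes_through_center_curve_germ[OF \<gamma>] passes_through_center_curve_germ[OF \<sigma>]
      by (simp add: g h)
    ultimately have "(\<gamma>, \<sigma>) \<in> curve_rel L M k a"
      by (rule same_off_center_curve_rel[OF \<gamma> \<sigma>])
    then show "g = h"
      unfolding g h curve_germ_def by (rule equiv_class_eq[OF equiv_curve_rel])
  next
    assume "g = h"
    then show "germ_dist L M a g h = \<zero>\<^bsub>hardy_field L M\<^esub>"
      using pseudo gS unfolding pseudometric_over_def by simp
  qed
qed

end

text \<open>The copy of M along h is a model of T on the type over which the hypothesis ranges;
  o-minimality of the copy then passes back to M.\<close>

lemma o_minimal_theory_imp_o_minimal:
  fixes M :: "('f, 'r, 'm) fo_structure" and h :: "'m \<Rightarrow> 'u"
  assumes "o_minimal_theory TYPE('u) L T" "models L M T" "inj h"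
  shows "o_minimal L M"
proof -
  interpret structure_copy h "the_inv h" M L
    by unfold_locales (rule the_inv_f_f[OF assms(3)])
  have "o_minimal L (structure_image h (the_inv h) M)"
    using assms(1) models_structure_image[OF assms(2)] unfolding o_minimal_theory_def by blast
  then show ?thesis
    by (rule o_minimal_structure_image)
qed

theorem proposition6p2:
  fixes L :: "('f, 'r) language"
    and T :: "('f, 'r) fm set"
    and M :: "('f, 'r, 'm::linordered_field) fo_structure"
    and k :: nat
    and a :: "'m list"
  assumes "expands_ordered_ring_language L"
    and "\<forall>\<phi>\<in>T. sentence L \<phi>"
    and "expands_RCF TYPE('m + ('f, 'r) fm) L T"
    and "complete_theory TYPE('m + ('f, 'r) fm) L T"
    and "o_minimal_theory TYPE('m + ('f, 'r) fm) L T"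
    and "has_quantifier_elimination TYPE('m + ('f, 'r) fm) L T"
    and "universally_axiomatizable TYPE('m + ('f, 'r) fm) L T"
    and "models L M T"
    and "ordered_field_structure L M"
    and "length a = k"
  shows "germ_dist_well_defined L M k a \<and>
    pseudometric_over (hardy_field L M) (curve_germs L M k a) (germ_dist L M a) \<and>
    (\<forall>\<gamma>\<in>curves_at L M k a. \<forall>\<sigma>\<in>curves_at L M k a.
       germ_dist L M a (curve_germ L M k a \<gamma>) (curve_germ L M k a \<sigma>) = \<zero>\<^bsub>hardy_field L M\<^esub> \<longleftrightarrow>
          same_off_center a \<gamma> \<sigma>) \<and>
    metric_over (hardy_field L M) {g \<in> curve_germs L M k a. \<not> passes_through_center a g} (germ_dist L M a) \<and>
    metric_over (hardy_field L M) {g \<in> curve_germs L M k a. passes_through_center a g} (germ_dist L M a)"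
proof -
  have "o_minimal L M"
    by (rule o_minimal_theory_imp_o_minimal[OF assms(5,8) inj_Inl])
  then interpret o_minimal_expansion L M
    using assms(1,9) by unfold_locales
  show ?thesis
    using germ_dist_well_defined[OF assms(10)] pseudometric_germ_dist[OF assms(10)]
      germ_dist_eq_0_iff[OF _ _ assms(10)]
      metric_germ_dist[OF assms(10), of False] metric_germ_dist[OF assms(10), of True]
    by simp
qed

end
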